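(* Let $B$ be a prime non-orientable bouquet. Then ${}^{\partial}\varepsilon_{B}(z)=2^{e(B)}z^{b}$ for some integer $b\ge 0$ if and only if $B=B_{\overline{1}}$, the bouquet with exactly one edge, that edge being a twisted loop (signed rotation $(1,-1)$).
   Context: Ribbon graphs are finite, possibly non-orientable, considered up to equivalence. For a ribbon graph $G$, let $v(G),e(G),f(G)$ be its numbers of vertices, edges and boundary components. For connected $G$ the Euler genus $\varepsilon(G)$ is defined by $2-\varepsilon(G)=v(G)-e(G)+f(G)$. For $A\subseteq E(G)$ the partial dual $G^{A}$ is obtained as follows: take the spanning ribbon subgraph $(V(G),A)$, glue a disc to $G$ along each boundary component of this subgraph (these discs are the vertex-discs of $G^A$), and remove the interiors of all vertex-discs of $G$; the edge-ribbons are kept as the edges of $G^A$. The partial-dual Euler genus polynomial of $G$ is ${}^{\partial}\varepsilon_{G}(z)=\sum_{A\subseteq E(G)}z^{\varepsilon(G^{A})}$. A bouquet is a ribbon graph with exactly one vertex. A loop $e$ at the vertex-disc $v$ is twisted if $e\cup v$ is homeomorphic to a Möbius band, and untwisted otherwise. A bouquet is non-orientable if and only if it has at least one twisted loop. The intersection graph $I(B)$ of a bouquet $B$ is the graph with vertex set $E(B)$ in which distinct $e$ and $f$ are adjacent if and only if their ends are met in the cyclic order $e\cdots f\cdots e\cdots f\cdots$ when travelling around the boundary of the unique vertex of $B$. A bouquet is prime if its intersection graph is connected. *)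

theory Defs
  imports
    "HOL-Computational_Algebra.Polynomial"
    "Graph_Theory.Digraph_Component"
begin

section \<open>Ribbon graphs\<close>

text \<open>
  A ribbon graph, up to equivalence, is encoded by its flags. A flag is a corner of an edge-ribbon,
  so every edge-ribbon (a rectangle glued to vertex-discs along two opposite ends) has four flags.
  Each of the following three maps sends a flag to the other endpoint of a boundary arc:
  \<^item> \<open>across\<close>: an end of the ribbon, along which it is attached to a vertex-disc;
  \<^item> \<open>along\<close>: a free side of the ribbon;
  \<^item> \<open>around\<close>: an arc of the boundary of a vertex-disc between two consecutive ribbon ends.
  A vertex-disc that meets no edge has no flag; \<open>isolated\<close> is the number of such discs.
  Non-orientable ribbon graphs are included, as no orientation of the flags is prescribed.
\<close>

record 'a ribbon_graph =
  flags :: "'a set"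
  across :: "'a \<Rightarrow> 'a"
  along :: "'a \<Rightarrow> 'a"
  around :: "'a \<Rightarrow> 'a"
  isolated :: nat

definition free_involution_on :: "'a set \<Rightarrow> ('a \<Rightarrow> 'a) \<Rightarrow> bool" where
  "free_involution_on S p \<longleftrightarrow> (\<forall>x\<in>S. p x \<in> S \<and> p (p x) = x \<and> p x \<noteq> x)"

definition ribbon_graph :: "'a ribbon_graph \<Rightarrow> bool" where
  "ribbon_graph G \<longleftrightarrow>
     finite (flags G) \<and>
     free_involution_on (flags G) (across G) \<and>
     free_involution_on (flags G) (along G) \<and>
     free_involution_on (flags G) (around G) \<and>
     (\<forall>x\<in>flags G. along G (across G x) = across G (along G x) \<and> along G x \<noteq> across G x)"

definition orbits_of :: "'a set \<Rightarrow> ('a \<Rightarrow> 'a) \<Rightarrow> ('a \<Rightarrow> 'a) \<Rightarrow> 'a set set" where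
  "orbits_of S p q = S // ({(x, p x) | x. x \<in> S} \<union> {(x, q x) | x. x \<in> S})\<^sup>*"

text \<open>An edge is identified with the set of its four flags.\<close>

definition edges :: "'a ribbon_graph \<Rightarrow> 'a set set" where
  "edges G = orbits_of (flags G) (across G) (along G)"

definition num_edges :: "'a ribbon_graph \<Rightarrow> nat" where
  "num_edges G = card (edges G)"

definition num_vertices :: "'a ribbon_graph \<Rightarrow> nat" where
  "num_vertices G = card (orbits_of (flags G) (around G) (across G)) + isolated G"

text \<open>
  The boundary of the spanning ribbon subgraph with edge set \<open>A\<close> consists of the arcs \<open>around\<close>,
  the free sides of the ribbons in \<open>A\<close> and, since the ribbons outside \<open>A\<close> are deleted, the arcs on
  the vertex-discs where those ribbons were attached.
\<close>

definition boundary_step :: "'a ribbon_graph \<Rightarrow> 'a set set \<Rightarrow> 'a \<Rightarrow> 'a" where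
  "boundary_step G A x = (if x \<in> \<Union>A then along G x else across G x)"

definition num_boundary_components :: "'a ribbon_graph \<Rightarrow> 'a set set \<Rightarrow> nat" where
  "num_boundary_components G A =
     card (orbits_of (flags G) (around G) (boundary_step G A)) + isolated G"

definition num_faces :: "'a ribbon_graph \<Rightarrow> nat" where
  "num_faces G = num_boundary_components G (edges G)"

text \<open>The Euler genus is only meaningful for connected ribbon graphs, where it is non-negative.\<close>

definition euler_genus :: "'a ribbon_graph \<Rightarrow> int" where
  "euler_genus G = 2 - (int (num_vertices G) - int (num_edges G) + int (num_faces G))"

text \<open>
  The boundaries of the vertex-discs of the partial dual are the boundary components of the spanning
  ribbon subgraph with edge set \<open>A\<close>. So a ribbon in \<open>A\<close> is now attached along its former free sides
  and its former ends become free, while a ribbon outside \<open>A\<close> stays attached along its ends.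
\<close>

definition partial_dual :: "'a ribbon_graph \<Rightarrow> 'a set set \<Rightarrow> 'a ribbon_graph" where
  "partial_dual G A = G\<lparr>
     across := boundary_step G A,
     along := (\<lambda>x. if x \<in> \<Union>A then across G x else along G x)\<rparr>"

text \<open>
  Partial duals of a connected ribbon graph are connected, hence \<open>nat\<close> does not truncate here
  when \<open>G\<close> is connected.
\<close>

definition partial_dual_genus_poly :: "'a ribbon_graph \<Rightarrow> int poly" where
  "partial_dual_genus_poly G =
     (\<Sum>A\<in>Pow (edges G). monom 1 (nat (euler_genus (partial_dual G A))))"

text \<open>
  An orientation of the surface is a choice of direction for all boundary arcs of discs that is
  opposite on glued arcs; equivalently a 2-colouring of the flags alternating along all three maps.
\<close>

definition orientable :: "'a ribbon_graph \<Rightarrow> bool" where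
  "orientable G \<longleftrightarrow> (\<exists>c :: 'a \<Rightarrow> bool. \<forall>x\<in>flags G.
     c (across G x) \<noteq> c x \<and> c (along G x) \<noteq> c x \<and> c (around G x) \<noteq> c x)"

text \<open>
  Equivalence is homeomorphism of the surfaces preserving vertex-discs and edge-ribbons; it may
  reverse local orientations.
\<close>

definition ribbon_equiv :: "'a ribbon_graph \<Rightarrow> 'b ribbon_graph \<Rightarrow> bool" where
  "ribbon_equiv G H \<longleftrightarrow> isolated G = isolated H \<and>
     (\<exists>\<phi>. bij_betw \<phi> (flags G) (flags H) \<and>
       (\<forall>x\<in>flags G. \<phi> (across G x) = across H (\<phi> x) \<and>
                    \<phi> (along G x) = along H (\<phi> x) \<and>
                    \<phi> (around G x) = around H (\<phi> x)))"


section \<open>Bouquets\<close>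

definition bouquet :: "'a ribbon_graph \<Rightarrow> bool" where
  "bouquet B \<longleftrightarrow> ribbon_graph B \<and> num_vertices B = 1"

text \<open>
  In a bouquet, iterating \<open>around \<circ> across\<close> from any flag travels around the boundary of the vertex
  and visits each of the \<open>2 * num_edges B\<close> ribbon ends exactly once (at one of its two flags) in
  each turn.
\<close>

definition interlaced :: "'a ribbon_graph \<Rightarrow> 'a set \<Rightarrow> 'a set \<Rightarrow> bool" where
  "interlaced B e f \<longleftrightarrow>
     (\<exists>x\<in>flags B. \<exists>i j k l. i < j \<and> j < k \<and> k < l \<and> l < 2 * num_edges B \<and>
       ((around B \<circ> across B) ^^ i) x \<in> e \<and> ((around B \<circ> across B) ^^ j) x \<in> f \<and>
       ((around B \<circ> across B) ^^ k) x \<in> e \<and> ((around B \<circ> across B) ^^ l) x \<in> f)"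

definition intersection_graph :: "'a ribbon_graph \<Rightarrow> 'a set pair_pre_digraph" where
  "intersection_graph B = \<lparr>pverts = edges B,
     parcs = {(e, f). e \<in> edges B \<and> f \<in> edges B \<and> e \<noteq> f \<and> interlaced B e f}\<rparr>"

definition prime_bouquet :: "'a ribbon_graph \<Rightarrow> bool" where
  "prime_bouquet B \<longleftrightarrow> bouquet B \<and> connected (with_proj (intersection_graph B))"

text \<open>
  The bouquet of a signed rotation: the list gives the edges (the absolute values) met in cyclic
  order around the vertex, each edge occurring twice. The loop is untwisted if its two signs agree
  and twisted if they differ. The ribbon end at position \<open>i\<close> has first flag \<open>(i, False)\<close> and last
  flag \<open>(i, True)\<close> in the direction of travel; the sides of a ribbon join first flags to last flags
  if it forms an annulus with the vertex, and first to first, last to last if it forms a Moebius band.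
\<close>

definition other_end :: "int list \<Rightarrow> nat \<Rightarrow> nat" where
  "other_end xs i = (THE j. j < length xs \<and> j \<noteq> i \<and> \<bar>xs ! j\<bar> = \<bar>xs ! i\<bar>)"

definition bouquet_of_rotation :: "int list \<Rightarrow> (nat \<times> bool) ribbon_graph" where
  "bouquet_of_rotation xs = \<lparr>
     flags = {..<length xs} \<times> UNIV,
     across = (\<lambda>(i, s). (i, \<not> s)),
     along = (\<lambda>(i, s). (other_end xs i, if xs ! other_end xs i = xs ! i then \<not> s else s)),
     around = (\<lambda>(i, s). if s then (Suc i mod length xs, False)
                        else ((i + length xs - 1) mod length xs, True)),
     isolated = (if xs = [] then 1 else 0)\<rparr>"

lemma other_end_single_loop [simp]:
  "other_end [a, - a] 0 = Suc 0" "other_end [a, - a] (Suc 0) = 0"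
  unfolding other_end_def by (rule the_equality; auto simp: less_Suc_eq)+

definition twisted_loop_bouquet :: "(nat \<times> bool) ribbon_graph" where
  "twisted_loop_bouquet = bouquet_of_rotation [1, - 1]"

lemma flags_twisted_loop_bouquet:
  "flags twisted_loop_bouquet = {(0, False), (0, True), (Suc 0, False), (Suc 0, True)}"
  by (auto simp: twisted_loop_bouquet_def bouquet_of_rotation_def less_Suc_eq)

lemma maps_twisted_loop_bouquet [simp]:
  "across twisted_loop_bouquet (i, s) = (i, \<not> s)"
  "along twisted_loop_bouquet (0, s) = (Suc 0, s)"
  "along twisted_loop_bouquet (Suc 0, s) = (0, s)"
  "around twisted_loop_bouquet (0, s) = (Suc 0, \<not> s)"
  "around twisted_loop_bouquet (Suc 0, s) = (0, \<not> s)"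
  "isolated twisted_loop_bouquet = 0"
  by (auto simp: twisted_loop_bouquet_def bouquet_of_rotation_def)

lemma ribbon_graph_twisted_loop_bouquet: "ribbon_graph twisted_loop_bouquet"
  by (auto simp: ribbon_graph_def free_involution_on_def flags_twisted_loop_bouquet)

lemma not_orientable_twisted_loop_bouquet: "\<not> orientable twisted_loop_bouquet"
  by (auto simp: orientable_def flags_twisted_loop_bouquet)

lemma orbits_of_eq_singleton:
  assumes "x \<in> S" and "\<And>y. y \<in> S \<Longrightarrow> p y \<in> S \<and> q y \<in> S"
    and "\<And>y z. y \<in> S \<Longrightarrow> z \<in> S \<Longrightarrow>
      (y, z) \<in> ({(x, p x) | x. x \<in> S} \<union> {(x, q x) | x. x \<in> S})\<^sup>*"
  shows "orbits_of S p q = {S}"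
proof -
  let ?R = "{(x, p x) | x. x \<in> S} \<union> {(x, q x) | x. x \<in> S}"
  have closed: "z \<in> S" if "(y, z) \<in> ?R\<^sup>*" "y \<in> S" for y z
    using that by (induction rule: rtrancl_induct) (use assms(2) in auto)
  have "?R\<^sup>* `` {y} = S" if "y \<in> S" for y
    using that closed assms(3) by blast
  then show ?thesis
    using assms(1) unfolding orbits_of_def quotient_def by auto
qed

lemma one_edge_twisted_loop_bouquet: "num_edges twisted_loop_bouquet = 1"
proof -
  let ?G = twisted_loop_bouquet
  let ?S = "flags ?G"
  let ?R = "{(x, across ?G x) | x. x \<in> ?S} \<union> {(x, along ?G x) | x. x \<in> ?S}"
  have 1: "(x, across ?G x) \<in> ?R\<^sup>*" "(x, along ?G x) \<in> ?R\<^sup>*"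
    "(x, along ?G (across ?G x)) \<in> ?R\<^sup>*" if "x \<in> ?S" for x
  proof -
    have closed: "across ?G x \<in> ?S"
      using that ribbon_graph_twisted_loop_bouquet
      by (simp add: ribbon_graph_def free_involution_on_def)
    have "(x, across ?G x) \<in> ?R" "(x, along ?G x) \<in> ?R"
      "(across ?G x, along ?G (across ?G x)) \<in> ?R"
      using that closed by blast+
    then show "(x, across ?G x) \<in> ?R\<^sup>*" "(x, along ?G x) \<in> ?R\<^sup>*"
      "(x, along ?G (across ?G x)) \<in> ?R\<^sup>*"
      by (meson r_into_rtrancl rtrancl_trans)+
  qed
  have "(y, z) \<in> ?R\<^sup>*" if "y \<in> ?S" "z \<in> ?S" for y z
  proof -
    have "z = y \<or> z = across ?G y \<or> z = along ?G y \<or> z = along ?G (across ?G y)"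
      using that by (auto simp: flags_twisted_loop_bouquet)
    then show ?thesis
      using 1[OF that(1)] by auto
  qed
  moreover have "(0, False) \<in> ?S"
    by (simp add: flags_twisted_loop_bouquet)
  moreover have "across ?G y \<in> ?S \<and> along ?G y \<in> ?S" if "y \<in> ?S" for y
    using that ribbon_graph_twisted_loop_bouquet
    by (simp add: ribbon_graph_def free_involution_on_def)
  ultimately have "edges ?G = {?S}"
    unfolding edges_def
    by (intro orbits_of_eq_singleton)
  then show ?thesis
    by (simp add: num_edges_def)
qed

lemma bouquet_twisted_loop_bouquet: "bouquet twisted_loop_bouquet"
proof -
  let ?G = twisted_loop_bouquet
  let ?S = "flags ?G"
  let ?R = "{(x, around ?G x) | x. x \<in> ?S} \<union> {(x, across ?G x) | x. x \<in> ?S}"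
  have 1: "(x, around ?G x) \<in> ?R\<^sup>*" "(x, across ?G x) \<in> ?R\<^sup>*"
    "(x, around ?G (across ?G x)) \<in> ?R\<^sup>*" if "x \<in> ?S" for x
  proof -
    have closed: "across ?G x \<in> ?S"
      using that ribbon_graph_twisted_loop_bouquet
      by (simp add: ribbon_graph_def free_involution_on_def)
    have "(x, around ?G x) \<in> ?R" "(x, across ?G x) \<in> ?R"
      "(across ?G x, around ?G (across ?G x)) \<in> ?R"
      using that closed by blast+
    then show "(x, around ?G x) \<in> ?R\<^sup>*" "(x, across ?G x) \<in> ?R\<^sup>*"
      "(x, around ?G (across ?G x)) \<in> ?R\<^sup>*"
      by (meson r_into_rtrancl rtrancl_trans)+
  qed
  have "(y, z) \<in> ?R\<^sup>*" if "y \<in> ?S" "z \<in> ?S" for y z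
  proof -
    have "z = y \<or> z = around ?G y \<or> z = across ?G y \<or> z = around ?G (across ?G y)"
      using that by (auto simp: flags_twisted_loop_bouquet)
    then show ?thesis
      using 1[OF that(1)] by auto
  qed
  moreover have "(0, False) \<in> ?S"
    by (simp add: flags_twisted_loop_bouquet)
  moreover have "around ?G y \<in> ?S \<and> across ?G y \<in> ?S" if "y \<in> ?S" for y
    using that ribbon_graph_twisted_loop_bouquet
    by (simp add: ribbon_graph_def free_involution_on_def)
  ultimately have "orbits_of ?S (around ?G) (across ?G) = {?S}"
    by (intro orbits_of_eq_singleton)
  then show ?thesis
    by (simp add: bouquet_def num_vertices_def ribbon_graph_twisted_loop_bouquet)
qed

end

theory Submission
  imports Defs
begin

text \<open>
  For a bouquet \<open>B\<close> let \<open>f A\<close> be the number of boundary components of the spanning ribbon subgraph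
  with edge set \<open>A\<close>. Then \<open>B\<^sup>A\<close> has \<open>f A\<close> vertices and \<open>f (E - A)\<close> faces, so all Euler genera agree
  iff \<open>f A + f (E - A) = f E + 1\<close> for every \<open>A\<close>. By non-orientability there is a twisted loop. Let
  \<open>v\<^sub>0, \<dots>, v\<^sub>n\<close> be a shortest path in the intersection graph from a twisted loop to a given edge.
  The adjacency matrix over GF(2) of every initial segment of the path, with diagonal entries 1
  at twisted loops, is nonsingular, so these segments have one boundary component. Hence deleting
  \<open>v\<^sub>0, \<dots>, v\<^sub>n\<close> from \<open>B\<close> one after the other never changes the number of faces, which is only
  possible if both sides of each \<open>v\<^sub>i\<close> lie in the same face of \<open>B\<close>. As every edge is reached, \<open>B\<close>
  has one face, and therefore \<open>f A = 1\<close> for every \<open>A\<close>. But an untwisted loop has two boundary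
  components, and so have two interlaced twisted loops. So all loops are twisted, no two of them are
  interlaced, and there is only one since \<open>B\<close> is prime.
\<close>

section \<open>Orbits of two involutions\<close>

text \<open>The pairs \<open>{x, p x}\<close> partition \<open>X\<close>, and the induction removes
  one pair at a time. Both parity arguments about faces rest on this.\<close>

lemma even_card_free_involution:
  assumes "finite X" "free_involution_on X p"
  shows "even (card X)"
  using assms
proof (induction "card X" arbitrary: X rule: less_induct)
  case less
  show ?case
  proof (cases "X = {}")
    case False
    then obtain x where x: "x \<in> X" by blast
    then have px: "p x \<in> X" "p (p x) = x" "p x \<noteq> x"
      using less.prems by (auto simp: free_involution_on_def)
    let ?Y = "X - {x, p x}"
    have card: "card X = card ?Y + 2"
    proof -
      have "card {x, p x} = 2" using px by simp
      moreover have "card ?Y = card X - card {x, p x}"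
        using less.prems x px by (intro card_Diff_subset) auto
      moreover have "card {x, p x} \<le> card X"
        using less.prems x px by (intro card_mono) auto
      ultimately show ?thesis by simp
    qed
    moreover have "free_involution_on ?Y p"
      unfolding free_involution_on_def
    proof
      fix y assume y: "y \<in> ?Y"
      with less.prems have "p y \<in> X" "p (p y) = y" "p y \<noteq> y"
        by (auto simp: free_involution_on_def)
      with y px show "p y \<in> ?Y \<and> p (p y) = y \<and> p y \<noteq> y" by auto
    qed
    ultimately have "even (card ?Y)" using less.prems by (intro less.hyps) auto
    with card show ?thesis by simp
  qed simp
qed

definition reach :: "'a set \<Rightarrow> ('a \<Rightarrow> 'a) \<Rightarrow> ('a \<Rightarrow> 'a) \<Rightarrow> ('a \<times> 'a) set" where
  "reach S p q = ({(x, p x) | x. x \<in> S} \<union> {(x, q x) | x. x \<in> S})\<^sup>*"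

lemma orbits_of_reach: "orbits_of S p q = S // reach S p q"
  by (simp add: orbits_of_def reach_def)

lemma reach_refl [simp]: "(x, x) \<in> reach S p q"
  by (simp add: reach_def)

lemma reach_trans: "(x, y) \<in> reach S p q \<Longrightarrow> (y, z) \<in> reach S p q \<Longrightarrow> (x, z) \<in> reach S p q"
  unfolding reach_def by (rule rtrancl_trans)

lemma reach_step1: "x \<in> S \<Longrightarrow> (x, p x) \<in> reach S p q"
  unfolding reach_def by (rule r_into_rtrancl) blast

lemma reach_step2: "x \<in> S \<Longrightarrow> (x, q x) \<in> reach S p q"
  unfolding reach_def by (rule r_into_rtrancl) blast

lemma reach_closed:
  assumes "(x, y) \<in> reach S p q" "x \<in> T"
    "\<And>z. z \<in> T \<Longrightarrow> z \<in> S \<Longrightarrow> p z \<in> T" "\<And>z. z \<in> T \<Longrightarrow> z \<in> S \<Longrightarrow> q z \<in> T"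
  shows "y \<in> T"
  using assms(1,2) unfolding reach_def
  by (induction rule: rtrancl_induct) (use assms(3,4) in auto)

lemma reach_subset:
  assumes "\<And>x. x \<in> S \<Longrightarrow> (x, p x) \<in> reach S p' q'" "\<And>x. x \<in> S \<Longrightarrow> (x, q x) \<in> reach S p' q'"
  shows "reach S p q \<subseteq> reach S p' q'"
proof -
  have "{(x, p x) | x. x \<in> S} \<union> {(x, q x) | x. x \<in> S} \<subseteq> reach S p' q'"
    using assms by auto
  then have "reach S p q \<subseteq> (reach S p' q')\<^sup>*"
    unfolding reach_def[of S p q] by (rule rtrancl_mono)
  then show ?thesis by (simp add: reach_def)
qed

lemma reach_sym:
  assumes "free_involution_on S p" "free_involution_on S q" "(x, y) \<in> reach S p q"
  shows "(y, x) \<in> reach S p q"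
proof -
  have "sym ({(x, p x) | x. x \<in> S} \<union> {(x, q x) | x. x \<in> S})"
  proof (rule symI)
    fix u v assume "(u, v) \<in> {(x, p x) | x. x \<in> S} \<union> {(x, q x) | x. x \<in> S}"
    then have "u \<in> S" "v = p u \<or> v = q u" by auto
    then have "v \<in> S" "u = p v \<or> u = q v"
      using assms(1,2) by (auto simp: free_involution_on_def)
    then show "(v, u) \<in> {(x, p x) | x. x \<in> S} \<union> {(x, q x) | x. x \<in> S}" by auto
  qed
  then show ?thesis
    using assms(3) unfolding reach_def by (rule symD[OF sym_rtrancl])
qed

text \<open>The closure is reflexive on the whole type, with points outside \<open>S\<close> related
  only to themselves; hence the carrier \<open>UNIV\<close>, although classes are later counted on
  \<open>S\<close> alone.\<close>

lemma equiv_reach: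
  assumes "free_involution_on S p" "free_involution_on S q"
  shows "equiv UNIV (reach S p q)"
proof (rule equivI)
  show "refl (reach S p q)" by (simp add: refl_on_def)
  show "sym (reach S p q)" using reach_sym[OF assms] by (rule symI)
  show "trans (reach S p q)" by (rule transI) (rule reach_trans)
qed simp

lemma finite_orbits: "finite S \<Longrightarrow> finite (orbits_of S p q)"
  by (simp add: orbits_of_def quotient_def)

lemma orbits_of_cong:
  assumes "\<And>x. x \<in> S \<Longrightarrow> q x = q' x"
  shows "orbits_of S p q = orbits_of S p q'"
proof -
  have "{(x, q x) |x. x \<in> S} = {(x, q' x) |x. x \<in> S}"
    using assms by (intro equalityI subrelI) auto
  then show ?thesis by (simp add: orbits_of_def)
qed

lemma one_orbit_iff:
  assumes "free_involution_on S p" "free_involution_on S q" "S \<noteq> {}"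
  shows "card (orbits_of S p q) = 1 \<longleftrightarrow> (\<forall>x\<in>S. \<forall>y\<in>S. (x, y) \<in> reach S p q)"
proof
  assume "card (orbits_of S p q) = 1"
  then obtain X where X: "S // reach S p q = {X}"
    unfolding orbits_of_reach by (rule card_1_singletonE)
  show "\<forall>x\<in>S. \<forall>y\<in>S. (x, y) \<in> reach S p q"
  proof (intro ballI)
    fix x y assume "x \<in> S" "y \<in> S"
    then have "reach S p q `` {x} \<in> {X}" "reach S p q `` {y} \<in> {X}"
      unfolding X[symmetric] by (blast intro: quotientI)+
    then have "reach S p q `` {x} = reach S p q `` {y}" by blast
    then show "(x, y) \<in> reach S p q"
      using equiv_reach[OF assms(1,2)] by (simp add: eq_equiv_class_iff)
  qed
next
  assume *: "\<forall>x\<in>S. \<forall>y\<in>S. (x, y) \<in> reach S p q"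
  obtain x where x: "x \<in> S" using assms(3) by blast
  have "orbits_of S p q = {S}"
    using x
  proof (rule orbits_of_eq_singleton)
    fix y assume "y \<in> S" then show "p y \<in> S \<and> q y \<in> S"
      using assms(1,2) by (simp add: free_involution_on_def)
  next
    fix y z assume "y \<in> S" "z \<in> S"
    with * show "(y, z) \<in> ({(x, p x) |x. x \<in> S} \<union> {(x, q x) |x. x \<in> S})\<^sup>*"
      unfolding reach_def by blast
  qed
  then show "card (orbits_of S p q) = 1" by simp
qed

text \<open>Enlarging each \<open>r\<close>-class to the \<open>r'\<close>-class containing it is a
  surjection, and the classes of \<open>x\<close> and \<open>y\<close> have the same image.\<close>

lemma card_quotient_strict:
  assumes "finite S" "equiv UNIV r" "equiv UNIV r'" "r \<subseteq> r'"
    and "x \<in> S" "y \<in> S" "(x, y) \<in> r'" "(x, y) \<notin> r"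
  shows "card (S // r') < card (S // r)"
proof -
  let ?f = "\<lambda>X. r' `` X"
  have f: "?f (r `` {z}) = r' `` {z}" for z
  proof
    show "?f (r `` {z}) \<subseteq> r' `` {z}"
      using assms(3,4) by (auto simp: equiv_def dest: transD)
    show "r' `` {z} \<subseteq> ?f (r `` {z})"
      using assms(2) by (auto simp: equiv_def refl_on_def)
  qed
  have fin: "finite (S // r)" using assms(1) by (simp add: quotient_def)
  have img: "?f ` (S // r) = S // r'"
    unfolding quotient_def by (auto simp: f image_UN)
  have "\<not> inj_on ?f (S // r)"
  proof
    assume "inj_on ?f (S // r)"
    moreover have "?f (r `` {x}) = ?f (r `` {y})"
      using assms(3,7) f by (simp add: equiv_class_eq)
    ultimately have "r `` {x} = r `` {y}"
      using assms(5,6) by (meson inj_onD quotientI)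
    then show False using assms(2,8) by (simp add: eq_equiv_class_iff)
  qed
  then have "card (?f ` (S // r)) < card (S // r)"
    using fin by (metis card_image_le eq_card_imp_inj_on le_neq_implies_less)
  then show ?thesis using img by simp
qed

text \<open>All that \<open>r'\<close> adds to \<open>r\<close> happens inside the classes of
  \<open>a\<close> and \<open>b\<close>. Discarding the class of \<open>a\<close>, the remaining
  \<open>r\<close>-classes inject into the \<open>r'\<close>-classes. The relations need not be
  comparable, so the map goes through a chosen representative.\<close>

lemma card_quotient_merge:
  assumes "finite S" "equiv UNIV r" "equiv UNIV r'" "a \<in> S"
    and sub: "\<And>x y. (x, y) \<in> r' \<Longrightarrow>
      (x, y) \<in> r \<or> ((a, x) \<in> r \<or> (b, x) \<in> r) \<and> ((a, y) \<in> r \<or> (b, y) \<in> r)"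
  shows "card (S // r) \<le> card (S // r') + 1"
proof -
  have fin: "finite (S // r)" "finite (S // r')" using assms(1) by (auto simp: quotient_def)
  define g where "g X = r' `` {SOME x. x \<in> X \<inter> S}" for X
  have pick: "(SOME x. x \<in> X \<inter> S) \<in> X \<inter> S" if "X \<in> S // r" for X
  proof -
    from that obtain s where "s \<in> S" "X = r `` {s}" by (rule quotientE)
    then have "s \<in> X \<inter> S" using assms(2) by (auto simp: equiv_def refl_on_def)
    then show ?thesis by (rule someI)
  qed
  have cls: "X = r `` {x}" if "X \<in> S // r" "x \<in> X" for X x
    using that assms(2) by (auto elim!: quotientE dest: equiv_class_eq)
  have "inj_on g (S // r - {r `` {a}})"
  proof (rule inj_onI)
    fix X Y assume XY: "X \<in> S // r - {r `` {a}}" "Y \<in> S // r - {r `` {a}}" "g X = g Y"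
    define x y where "x = (SOME x. x \<in> X \<inter> S)" and "y = (SOME x. x \<in> Y \<inter> S)"
    have x: "x \<in> X" "x \<in> S" and y: "y \<in> Y" "y \<in> S"
      using pick XY unfolding x_def y_def by blast+
    have X: "X = r `` {x}" and Y: "Y = r `` {y}" using cls XY x y by blast+
    have "(x, y) \<in> r'"
      using XY(3) assms(3) unfolding g_def x_def[symmetric] y_def[symmetric]
      by (simp add: eq_equiv_class_iff)
    moreover have "(a, x) \<notin> r" "(a, y) \<notin> r"
      using XY X Y assms(2) by (auto dest: equiv_class_eq)
    ultimately have "(x, y) \<in> r \<or> (b, x) \<in> r \<and> (b, y) \<in> r" using sub by blast
    then have "(x, y) \<in> r" using assms(2) unfolding equiv_def sym_def trans_def by blast
    then show "X = Y" using X Y assms(2) by (simp add: equiv_class_eq)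
  qed
  moreover have "g ` (S // r - {r `` {a}}) \<subseteq> S // r'"
    unfolding g_def using pick by (auto intro: quotientI)
  ultimately have "card (S // r - {r `` {a}}) \<le> card (S // r')"
    using fin by (metis card_inj_on_le)
  moreover have "r `` {a} \<in> S // r" using assms(4) by (rule quotientI)
  ultimately show ?thesis using fin by (simp add: card_Diff_singleton)
qed

section \<open>Walking around the vertex of a bouquet\<close>

text \<open>Nonemptiness excludes the bare disc, a bouquet without flags, which is
  orientable.\<close>

locale one_vertex =
  fixes B :: "'a ribbon_graph"
  assumes ribbon: "ribbon_graph B" and one: "num_vertices B = 1" and nonempty: "flags B \<noteq> {}"
begin

abbreviation "FL \<equiv> flags B"
abbreviation "ac \<equiv> across B"
abbreviation "al \<equiv> along B"
abbreviation "ar \<equiv> around B"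

definition turn :: "'a \<Rightarrow> 'a" where
  "turn x = around B (across B x)"

lemma turn_eq: "around B \<circ> across B = turn"
  by (auto simp: turn_def)

lemma finite_flags: "finite FL"
  using ribbon by (simp add: ribbon_graph_def)

lemma involutions: "free_involution_on FL ac" "free_involution_on FL al" "free_involution_on FL ar"
  using ribbon by (simp_all add: ribbon_graph_def)

lemma flag_maps [simp]:
  assumes "x \<in> FL"
  shows "ac x \<in> FL" "ac (ac x) = x" "ac x \<noteq> x" "x \<noteq> ac x"
    "al x \<in> FL" "al (al x) = x" "al x \<noteq> x" "x \<noteq> al x"
    "ar x \<in> FL" "ar (ar x) = x" "ar x \<noteq> x" "x \<noteq> ar x"
    "al (ac x) = ac (al x)" "al x \<noteq> ac x" "ac x \<noteq> al x"
proof -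
  show maps: "ac x \<in> FL" "ac (ac x) = x" "ac x \<noteq> x"
    "al x \<in> FL" "al (al x) = x" "al x \<noteq> x" "ar x \<in> FL" "ar (ar x) = x" "ar x \<noteq> x"
    using assms involutions by (simp_all add: free_involution_on_def)
  then show "x \<noteq> ac x" "x \<noteq> al x" "x \<noteq> ar x" by (metis, metis, metis)
  show "al (ac x) = ac (al x)" "al x \<noteq> ac x"
    using assms ribbon by (simp_all add: ribbon_graph_def)
  then show "ac x \<noteq> al x" by metis
qed

lemma isolated_eq_0: "isolated B = 0"
  and one_orbit: "card (orbits_of FL ar ac) = 1"
proof -
  have "orbits_of FL ar ac \<noteq> {}"
    using nonempty by (simp add: orbits_of_def quotient_def)
  then have "card (orbits_of FL ar ac) > 0"
    using finite_orbits[OF finite_flags] by (simp add: card_gt_0_iff)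
  then show "isolated B = 0" "card (orbits_of FL ar ac) = 1"
    using one by (auto simp: num_vertices_def)
qed

lemma connected: "x \<in> FL \<Longrightarrow> y \<in> FL \<Longrightarrow> (x, y) \<in> reach FL ar ac"
  using one_orbit unfolding one_orbit_iff[OF involutions(3,1) nonempty] by simp

text \<open>Having a single vertex serves as an induction principle: \<open>around\<close> and
  \<open>across\<close> act transitively on the flags.\<close>

lemma closed_eq_flags:
  assumes "T \<subseteq> FL" "x \<in> T" "\<And>z. z \<in> T \<Longrightarrow> ar z \<in> T" "\<And>z. z \<in> T \<Longrightarrow> ac z \<in> T"
  shows "T = FL"
proof -
  have "y \<in> T" if "y \<in> FL" for y
    using connected[of x y] assms that by (auto intro: reach_closed[of x y FL ar ac T])
  then show ?thesis using assms(1) by blast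
qed

lemma turn_in [simp]: "x \<in> FL \<Longrightarrow> (turn ^^ p) x \<in> FL"
  by (induction p) (auto simp: turn_def)

lemma across_around_turn [simp]: "x \<in> FL \<Longrightarrow> ac (ar (turn x)) = x"
  by (simp add: turn_def)

lemma turn_across_turn1 [simp]: "x \<in> FL \<Longrightarrow> turn (ac (turn x)) = ac x"
  by (simp add: turn_def)

lemma turn_inj: "x \<in> FL \<Longrightarrow> y \<in> FL \<Longrightarrow> (turn ^^ p) x = (turn ^^ p) y \<Longrightarrow> x = y"
proof (induction p)
  case (Suc p)
  then have "ac (ar (turn ((turn ^^ p) x))) = ac (ar (turn ((turn ^^ p) y)))" by simp
  then have "(turn ^^ p) x = (turn ^^ p) y" using Suc.prems(1,2) by simp
  with Suc show ?case by blast
qed simp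

text \<open>\<open>across\<close> conjugates \<open>turn\<close> into its inverse, as always for a
  product of two involutions (dihedral relation).\<close>

lemma turn_across_turn: "x \<in> FL \<Longrightarrow> (turn ^^ p) (ac ((turn ^^ p) x)) = ac x"
proof (induction p arbitrary: x)
  case (Suc p)
  have "(turn ^^ Suc p) (ac ((turn ^^ Suc p) x)) = turn ((turn ^^ p) (ac ((turn ^^ p) (turn x))))"
    by (simp add: funpow_swap1)
  also have "\<dots> = turn (ac (turn x))"
    using Suc.IH[of "turn x"] Suc.prems turn_in[of x 1] by simp
  also have "\<dots> = ac x" using Suc.prems by simp
  finally show ?case .
qed simp

text \<open>Neither \<open>across\<close> nor \<open>around\<close> has a fixed point, so no walk reverses its direction.\<close>

lemma turn_neq_across: "x \<in> FL \<Longrightarrow> (turn ^^ p) x \<noteq> ac x"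
proof
  assume x: "x \<in> FL" and eq: "(turn ^^ p) x = ac x"
  \<comment> \<open>A walk ending in its own reversal has a fixed flag in the middle: of
    \<open>across\<close> for even \<open>p\<close>, of \<open>around\<close> for odd
    \<open>p\<close>.\<close>
  define q where "q = p div 2"
  let ?w = "(turn ^^ q) x"
  have w: "?w \<in> FL" using x by simp
  consider "p = q + q" | "p = q + Suc q" unfolding q_def by linarith
  then show False
  proof cases
    case 1
    then have "(turn ^^ q) ?w = (turn ^^ q) (ac ?w)"
      using eq turn_across_turn[OF x] by (simp add: funpow_add)
    then have "?w = ac ?w" using w by (intro turn_inj[of ?w "ac ?w" q]) auto
    then show False using w by simp
  next
    case 2
    then have "(turn ^^ q) (turn ?w) = (turn ^^ q) (ac ?w)"
      using eq turn_across_turn[OF x] by (simp only: funpow_add comp_apply funpow.simps)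
    then have "turn ?w = ac ?w" using w turn_in[of ?w 1] by (intro turn_inj[of "turn ?w" "ac ?w" q]) auto
    then have "ar (ac ?w) = ac ?w" by (simp add: turn_def)
    moreover have "ac ?w \<in> FL" using w by simp
    ultimately show False using flag_maps(11) by blast
  qed
qed

lemma turn_neq_across_turn: "x \<in> FL \<Longrightarrow> (turn ^^ p) x \<noteq> ac ((turn ^^ q) x)"
proof
  assume x: "x \<in> FL" and eq: "(turn ^^ p) x = ac ((turn ^^ q) x)"
  then have "(turn ^^ (q + p)) x = ac x"
    using turn_across_turn[OF x, of q] by (simp add: funpow_add)
  then show False using turn_neq_across[OF x] by blast
qed

section \<open>Edges as orbits of the Klein four-group generated by \<open>across\<close> and
  \<open>along\<close>\<close>

definition edge_of :: "'a \<Rightarrow> 'a set" where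
  "edge_of x = {x, ac x, al x, ac (al x)}"

lemma edge_of_self [simp]: "x \<in> edge_of x"
  by (simp add: edge_of_def)

lemma edge_of_subset: "x \<in> FL \<Longrightarrow> edge_of x \<subseteq> FL"
  by (auto simp: edge_of_def)

lemma edge_of_eq:
  assumes "x \<in> FL" "y \<in> edge_of x"
  shows "edge_of y = edge_of x"
proof -
  consider "y = x" | "y = ac x" | "y = al x" | "y = ac (al x)"
    using assms(2) unfolding edge_of_def by blast
  then show ?thesis
    by cases (use assms(1) in \<open>simp_all add: edge_of_def insert_commute\<close>)
qed

lemma card_edge_of: "x \<in> FL \<Longrightarrow> card (edge_of x) = 4"
proof -
  assume x: "x \<in> FL"
  have "ac (al x) \<noteq> x" "ac (al x) \<noteq> ac x" using x flag_maps by metis+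
  then have "x \<noteq> ac (al x)" "ac x \<noteq> ac (al x)" by metis+
  with \<open>ac (al x) \<noteq> x\<close> show ?thesis using x by (simp add: edge_of_def)
qed

lemma reach_edge: "x \<in> FL \<Longrightarrow> reach FL ac al `` {x} = edge_of x"
proof
  assume x: "x \<in> FL"
  show "reach FL ac al `` {x} \<subseteq> edge_of x"
  proof
    fix y assume "y \<in> reach FL ac al `` {x}"
    then have "(x, y) \<in> reach FL ac al" by simp
    then show "y \<in> edge_of x"
      by (rule reach_closed) (use x in \<open>auto simp: edge_of_def\<close>)
  qed
  have "(x, ac x) \<in> reach FL ac al" "(x, al x) \<in> reach FL ac al"
    "(al x, ac (al x)) \<in> reach FL ac al"
    using x by (auto intro: reach_step1 reach_step2)
  then show "edge_of x \<subseteq> reach FL ac al `` {x}"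
    by (auto simp: edge_of_def intro: reach_trans)
qed

lemma edges_eq: "edges B = edge_of ` FL"
  using reach_edge by (auto simp: edges_def orbits_of_reach quotient_def)

lemma finite_edges: "finite (edges B)"
  using finite_flags by (simp add: edges_eq)

lemma edge_subset: "e \<in> edges B \<Longrightarrow> e \<subseteq> FL"
  using edge_of_subset by (auto simp: edges_eq)

lemma edge_eq:
  assumes "e \<in> edges B" "y \<in> e"
  shows "e = edge_of y"
proof -
  obtain x where "x \<in> FL" "e = edge_of x" using assms(1) unfolding edges_eq by blast
  then show ?thesis using edge_of_eq[of x y] assms(2) by simp
qed

lemma edge_nonempty: "e \<in> edges B \<Longrightarrow> \<exists>y. y \<in> e \<and> y \<in> FL"
  by (auto simp: edges_eq intro: edge_of_self)

lemma edges_disjoint: "e \<in> edges B \<Longrightarrow> h \<in> edges B \<Longrightarrow> y \<in> e \<Longrightarrow> y \<in> h \<Longrightarrow> e = h"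
  using edge_eq[of e y] edge_eq[of h y] by simp

lemma Union_edges: "\<Union>(edges B) = FL"
  using edge_of_subset edge_of_self by (auto simp: edges_eq)

lemma in_edge_maps [simp]:
  assumes "e \<in> edges B" "y \<in> e"
  shows "ac y \<in> e" "al y \<in> e"
proof -
  have "ac y \<in> edge_of y" "al y \<in> edge_of y" by (simp_all add: edge_of_def)
  then show "ac y \<in> e" "al y \<in> e" using edge_eq[OF assms] by (simp_all only:)
qed

lemma in_edge_iff [simp]:
  assumes "e \<in> edges B" "y \<in> FL"
  shows "ac y \<in> e \<longleftrightarrow> y \<in> e" "al y \<in> e \<longleftrightarrow> y \<in> e"
proof -
  show "ac y \<in> e \<longleftrightarrow> y \<in> e"
    using in_edge_maps(1)[OF assms(1), of y] in_edge_maps(1)[OF assms(1), of "ac y"] assms(2) by auto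
  show "al y \<in> e \<longleftrightarrow> y \<in> e"
    using in_edge_maps(2)[OF assms(1), of y] in_edge_maps(2)[OF assms(1), of "al y"] assms(2) by auto
qed

lemma card_flags: "card FL = 4 * num_edges B"
proof -
  have "card (\<Union>(edges B)) = (\<Sum>e\<in>edges B. card e)"
  proof (rule card_Union_disjoint)
    show "pairwise disjnt (edges B)"
      using edges_disjoint by (auto simp: pairwise_def disjnt_def)
    show "finite e" if "e \<in> edges B" for e
      using that edge_subset finite_flags finite_subset by blast
  qed
  also have "\<dots> = (\<Sum>e\<in>edges B. 4)"
    by (rule sum.cong) (auto simp: edges_eq card_edge_of)
  finally show ?thesis by (simp add: Union_edges num_edges_def)
qed

text \<open>The \<open>turn\<close>-orbit \<open>W\<close> of \<open>x\<close> and its image under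
  \<open>across\<close> are disjoint, equally large and together closed under both maps, so they are
  all flags. With four flags per edge, the length of the orbit is
  \<open>2 * num_edges B\<close>.\<close>

lemma turn_period: "x \<in> FL \<Longrightarrow> (turn ^^ (2 * num_edges B)) x = x"
  and turn_distinct: "x \<in> FL \<Longrightarrow> p < 2 * num_edges B \<Longrightarrow> q < 2 * num_edges B \<Longrightarrow>
    (turn ^^ p) x = (turn ^^ q) x \<Longrightarrow> p = q"
  and flag_position: "x \<in> FL \<Longrightarrow> z \<in> FL \<Longrightarrow>
    \<exists>p<2 * num_edges B. z = (turn ^^ p) x \<or> z = ac ((turn ^^ p) x)"
proof -
  assume x: "x \<in> FL"
  have cancel: "(turn ^^ (q - p)) x = x" if "p < q" "(turn ^^ p) x = (turn ^^ q) x" for p q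
  proof -
    have "(turn ^^ p) x = (turn ^^ (p + (q - p))) x" using that by simp
    then have "(turn ^^ p) x = (turn ^^ p) ((turn ^^ (q - p)) x)"
      by (simp only: funpow_add comp_apply)
    then show ?thesis using x by (metis turn_in turn_inj)
  qed
  have "\<not> inj (\<lambda>p. (turn ^^ p) x)"
  proof
    assume "inj (\<lambda>p. (turn ^^ p) x)"
    moreover have "range (\<lambda>p. (turn ^^ p) x) \<subseteq> FL" using x by auto
    ultimately show False
      using finite_flags by (metis finite_imageD finite_subset infinite_UNIV_nat)
  qed
  then obtain k l where "k \<noteq> l" "(turn ^^ k) x = (turn ^^ l) x"
    unfolding inj_def by blast
  then have "\<exists>i j. i < j \<and> (turn ^^ i) x = (turn ^^ j) x"
    by (cases k l rule: linorder_cases) (auto intro: sym)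
  then obtain i j where "i < j" "(turn ^^ i) x = (turn ^^ j) x" by blast
  with cancel have "j - i > 0 \<and> (turn ^^ (j - i)) x = x" by simp
  then have ex: "\<exists>n. n > 0 \<and> (turn ^^ n) x = x" by blast
  define n where "n = (LEAST n. n > 0 \<and> (turn ^^ n) x = x)"
  have n: "n > 0" "(turn ^^ n) x = x"
    using LeastI_ex[OF ex] by (auto simp: n_def)
  have least: "(turn ^^ m) x \<noteq> x" if "0 < m" "m < n" for m
    using that not_less_Least unfolding n_def by blast
  have inj: "p = q" if "p < n" "q < n" "(turn ^^ p) x = (turn ^^ q) x" for p q
  proof (rule ccontr)
    assume "p \<noteq> q"
    then consider "p < q" | "q < p" by linarith
    then show False
    proof cases
      case 1 with cancel[of p q] least[of "q - p"] that show False by simp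
    next
      case 2 with cancel[of q p] least[of "p - q"] that show False by simp
    qed
  qed
  define W where "W = (\<lambda>p. (turn ^^ p) x) ` {..<n}"
  have W_iff: "(turn ^^ p) x \<in> W" for p
  proof -
    have "(turn ^^ p) x = (turn ^^ (p mod n)) x" using funpow_mod_eq[OF n(2)] by simp
    then show ?thesis using n(1) unfolding W_def by auto
  qed
  have "W \<subseteq> FL" using x by (auto simp: W_def)
  have "W \<union> ac ` W = FL"
  proof (rule closed_eq_flags)
    show "W \<union> ac ` W \<subseteq> FL" using \<open>W \<subseteq> FL\<close> by auto
    show "x \<in> W \<union> ac ` W" using W_iff[of 0] by simp
    show "ac z \<in> W \<union> ac ` W" if "z \<in> W \<union> ac ` W" for z
      using that \<open>W \<subseteq> FL\<close> by auto
    show "ar z \<in> W \<union> ac ` W" if "z \<in> W \<union> ac ` W" for z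
      using that
    proof
      assume "z \<in> ac ` W"
      then obtain p where "z = ac ((turn ^^ p) x)" by (auto simp: W_def)
      then have "ar z = (turn ^^ Suc p) x" by (simp add: turn_def)
      then have "ar z \<in> W" using W_iff[of "Suc p"] by (simp only:)
      then show ?thesis by blast
    next
      assume "z \<in> W"
      then obtain p where p: "z = (turn ^^ p) x" by (auto simp: W_def)
      \<comment> \<open>Going once more around, by the period \<open>n\<close>, gives a predecessor
        also for \<open>p = 0\<close>.\<close>
      then have "z = (turn ^^ Suc (p + n - 1)) x"
        using n by (simp add: funpow_add)
      then have "ar z = ac ((turn ^^ (p + n - 1)) x)" using x by (simp add: turn_def)
      then show ?thesis using W_iff[of "p + n - 1"] by blast
    qed
  qed
  have "card W = n" unfolding W_def using inj by (auto simp: card_image inj_on_def)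
  moreover have "card (ac ` W) = card W"
  proof (rule card_image, rule inj_onI)
    fix u v assume "u \<in> W" "v \<in> W" "ac u = ac v"
    moreover from this have "u \<in> FL" "v \<in> FL" using \<open>W \<subseteq> FL\<close> by auto
    ultimately have "ac (ac u) = v" by simp
    with \<open>u \<in> FL\<close> show "u = v" by simp
  qed
  moreover have "W \<inter> ac ` W = {}"
    using turn_neq_across_turn[OF x] by (auto simp: W_def)
  moreover have "finite W" by (simp add: W_def)
  ultimately have "card FL = 2 * n"
    using \<open>W \<union> ac ` W = FL\<close> card_Un_disjoint[of W "ac ` W"] by simp
  then have n_eq: "n = 2 * num_edges B" using card_flags by simp
  show "(turn ^^ (2 * num_edges B)) x = x" using n n_eq by simp
  show "p < 2 * num_edges B \<Longrightarrow> q < 2 * num_edges B \<Longrightarrow>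
    (turn ^^ p) x = (turn ^^ q) x \<Longrightarrow> p = q"
    using inj n_eq by simp
  show "\<exists>p<2 * num_edges B. z = (turn ^^ p) x \<or> z = ac ((turn ^^ p) x)" if "z \<in> FL"
  proof -
    have "z \<in> W \<or> z \<in> ac ` W" using that \<open>W \<union> ac ` W = FL\<close> by blast
    then show ?thesis unfolding W_def n_eq by blast
  qed
qed

section \<open>Arcs, twisting and interlacing\<close>

text \<open>
  An arc of \<open>e\<close> is one of the two arcs into which the ends of \<open>e\<close> cut the boundary of the vertex,
  the flags at its two extremities included.
\<close>

definition is_arc :: "'a set \<Rightarrow> 'a set \<Rightarrow> bool" where
  "is_arc e C \<longleftrightarrow> C \<subseteq> FL \<and> (\<forall>z\<in>FL. ar z \<in> C \<longleftrightarrow> z \<in> C) \<and>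
     (\<forall>z\<in>FL. ac z \<in> C \<longleftrightarrow> (z \<in> C \<longleftrightarrow> z \<notin> e))"

lemma is_arcD:
  assumes "is_arc e C"
  shows "C \<subseteq> FL" "z \<in> FL \<Longrightarrow> ar z \<in> C \<longleftrightarrow> z \<in> C"
    "z \<in> FL \<Longrightarrow> ac z \<in> C \<longleftrightarrow> (z \<in> C \<longleftrightarrow> z \<notin> e)"
  using assms by (auto simp: is_arc_def)

text \<open>The set where two arcs of \<open>e\<close> agree is closed under \<open>around\<close>
  and \<open>across\<close>. So two arcs of \<open>e\<close> are equal or complementary, and
  \<open>linked\<close> does not depend on the choice.\<close>

lemma arcs_agree:
  assumes "is_arc e C" "is_arc e D" "y \<in> FL" "z \<in> FL" "y \<in> C \<longleftrightarrow> y \<in> D"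
  shows "z \<in> C \<longleftrightarrow> z \<in> D"
proof -
  have "{z \<in> FL. z \<in> C \<longleftrightarrow> z \<in> D} = FL"
    by (rule closed_eq_flags[of _ y])
      (use assms in \<open>auto simp: is_arcD(2,3)[OF assms(1)] is_arcD(2,3)[OF assms(2)]\<close>)
  then show ?thesis using assms(4) by blast
qed

text \<open>
  For \<open>e = h\<close> this says that the loop \<open>e\<close> is twisted, and otherwise that \<open>e\<close> and \<open>h\<close> are interlaced;
  so these are the entries of the adjacency matrix over GF(2) of the signed intersection graph.
\<close>

definition linked :: "'a set \<Rightarrow> 'a set \<Rightarrow> bool" where
  "linked e h \<longleftrightarrow> (\<exists>C. is_arc e C \<and> (\<exists>y\<in>h. (al y \<in> C) \<noteq> (y \<in> C)))"

text \<open>Neither the arc nor the flag matters: exchanging \<open>C\<close> for its complement, or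
  \<open>y\<close> for another flag of \<open>h\<close>, changes both memberships or none, because
  \<open>across\<close> acts alike at both ends of \<open>h\<close>.\<close>

lemma linked_iff:
  assumes "e \<in> edges B" "h \<in> edges B" "is_arc e C" "y \<in> h"
  shows "linked e h \<longleftrightarrow> (al y \<in> C) \<noteq> (y \<in> C)"
proof
  assume "linked e h"
  then obtain D z where D: "is_arc e D" and z: "z \<in> h" "(al z \<in> D) \<noteq> (z \<in> D)"
    unfolding linked_def by blast
  have y: "y \<in> FL" and "z \<in> FL" using edge_subset assms z by blast+
  then have *: "(al z \<in> C) \<noteq> (z \<in> C)"
    using arcs_agree[OF D assms(3), of z "al z"] arcs_agree[OF D assms(3), of "al z" z] z(2)
    by auto
  have ac: "ac w \<in> C \<longleftrightarrow> (w \<in> C \<longleftrightarrow> w \<notin> e)" if "w \<in> FL" for w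
    using is_arcD(3)[OF assms(3) that] .
  have "z \<in> edge_of y" using edge_eq assms z by blast
  then consider "z = y" | "z = ac y" | "z = al y" | "z = ac (al y)"
    unfolding edge_of_def by blast
  then show "(al y \<in> C) \<noteq> (y \<in> C)"
    by cases (use * y ac assms(1) in auto)
next
  assume "(al y \<in> C) \<noteq> (y \<in> C)"
  then show "linked e h" using assms unfolding linked_def by blast
qed

text \<open>Coordinates for a walk from \<open>x\<close>. The flag \<open>(turn ^^ p) x\<close> is
  where the walk enters the end at position \<open>p\<close>, before crossing it. Hence
  \<open>x\<close> still lies on the other arc, while the entry flag at position \<open>k\<close>,
  the second end of the edge, still lies on \<open>C\<close>.\<close>

definition positioned_arc :: "'a \<Rightarrow> nat \<Rightarrow> 'a set \<Rightarrow> bool" where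
  "positioned_arc x k C \<longleftrightarrow> 0 < k \<and> k < 2 * num_edges B \<and> is_arc (edge_of x) C \<and>
     (\<forall>p<2 * num_edges B. ((turn ^^ p) x \<in> edge_of x \<longleftrightarrow> p = 0 \<or> p = k) \<and>
       ((turn ^^ p) x \<in> C \<longleftrightarrow> 0 < p \<and> p \<le> k))"

lemma positioned_arcD:
  assumes "positioned_arc x k C"
  shows "0 < k" "k < 2 * num_edges B" "is_arc (edge_of x) C"
    "p < 2 * num_edges B \<Longrightarrow> (turn ^^ p) x \<in> edge_of x \<longleftrightarrow> p = 0 \<or> p = k"
    "p < 2 * num_edges B \<Longrightarrow> (turn ^^ p) x \<in> C \<longleftrightarrow> 0 < p \<and> p \<le> k"
  using assms unfolding positioned_arc_def by blast+

lemma arc_positions: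
  assumes x: "x \<in> FL"
  shows "\<exists>k C. positioned_arc x k C"
proof -
  let ?N = "2 * num_edges B"
  let ?t = "\<lambda>p. (turn ^^ p) x"
  have t: "?t p \<in> FL" for p using x by simp
  obtain k where k: "k < ?N" "al x = ?t k \<or> al x = ac (?t k)"
    using flag_position[OF x, of "al x"] x by auto
  have "k \<noteq> 0"
  proof
    assume "k = 0"
    with k(2) have "al x = x \<or> al x = ac x" by simp
    with x show False by auto
  qed
  then have k0: "0 < k" by simp
  have "edge_of x = {x, ac x, ?t k, ac (?t k)}"
    using k(2) t[of k] unfolding edge_of_def by (auto simp: insert_commute)
  then have "?t p \<in> edge_of x \<longleftrightarrow> ?t p = x \<or> ?t p = ?t k" for p
    using turn_neq_across[OF x, of p] turn_neq_across_turn[OF x, of p k] by simp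
  moreover have "?t p = x \<longleftrightarrow> p = 0" "?t p = ?t k \<longleftrightarrow> p = k" if "p < ?N" for p
    using turn_distinct[OF x that, of 0] turn_distinct[OF x that, of k] k k0
    by auto
  ultimately have on_edge: "?t p \<in> edge_of x \<longleftrightarrow> p = 0 \<or> p = k" if "p < ?N" for p
    using that by simp
  have edge: "edge_of x \<in> edges B" using x by (simp add: edges_eq)
  \<comment> \<open>The arc runs from the exit flag \<open>ac (?t 0)\<close> to the entry flag
    \<open>?t k\<close>: entry flags have \<open>0 < p \<le> k\<close>, exit flags
    \<open>p < k\<close>.\<close>
  define C where "C = {z. \<exists>p<?N. z = ?t p \<and> 0 < p \<and> p \<le> k \<or> z = ac (?t p) \<and> p < k}"
  have C1: "?t p \<in> C \<longleftrightarrow> 0 < p \<and> p \<le> k" if "p < ?N" for p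
    unfolding C_def using that turn_distinct[OF x that] turn_neq_across_turn[OF x] by blast
  have ac_inj: "ac (?t p) = ac (?t q) \<Longrightarrow> ?t p = ?t q" for p q
    using t flag_maps(2) by metis
  have C2: "ac (?t p) \<in> C \<longleftrightarrow> p < k" if "p < ?N" for p
  proof
    assume "ac (?t p) \<in> C"
    then obtain q where q: "q < ?N" "ac (?t p) = ?t q \<or> ac (?t p) = ac (?t q) \<and> q < k"
      unfolding C_def by blast
    then have "?t p = ?t q" "q < k"
      using ac_inj[of p q] turn_neq_across_turn[OF x, of q p] by auto
    then show "p < k" using turn_distinct[OF x that q(1)] by simp
  qed (use that in \<open>auto simp: C_def\<close>)
  \<comment> \<open>The walk closes up: behind \<open>x\<close> lies the exit flag of the last
    end.\<close>
  have last: "ar x = ac (?t (?N - 1))"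
  proof -
    have "x = turn (?t (?N - 1))"
      using turn_period[OF x] k funpow.simps(2)[of "?N - 1" turn] by simp
    then have "ar x = ar (turn (?t (?N - 1)))" by simp
    then show ?thesis using t[of "?N - 1"] by (simp add: turn_def)
  qed
  have "is_arc (edge_of x) C"
    unfolding is_arc_def
  proof (intro conjI ballI)
    show "C \<subseteq> FL" unfolding C_def using t by auto
  next
    fix z assume "z \<in> FL"
    then obtain p where p: "p < ?N" "z = ?t p \<or> z = ac (?t p)"
      using flag_position[OF x] by blast
    from p(2) show "ar z \<in> C \<longleftrightarrow> z \<in> C"
    proof
      assume z: "z = ?t p"
      show ?thesis
      proof (cases p)
        case 0
        then show ?thesis using z last C1[of 0] C2[of "?N - 1"] k p by auto
      next
        case (Suc q)
        have "ar z = ac (?t q)" using z Suc t[of q] by (simp add: turn_def)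
        then show ?thesis using z Suc C1[of p] C2[of q] p by auto
      qed
    next
      assume z: "z = ac (?t p)"
      have ar: "ar z = ?t (Suc p)" using z by (simp add: turn_def)
      show ?thesis
      proof (cases "Suc p = ?N")
        case True
        then have "ar z = ?t 0" unfolding ar using turn_period[OF x] by (simp only: funpow_0)
        then show ?thesis using z C1[of 0] C2[of p] p k True by auto
      next
        case False
        then show ?thesis using ar z C1[of "Suc p"] C2[of p] p by auto
      qed
    qed
  next
    fix z assume "z \<in> FL"
    then obtain p where p: "p < ?N" "z = ?t p \<or> z = ac (?t p)"
      using flag_position[OF x] by blast
    then show "ac z \<in> C \<longleftrightarrow> (z \<in> C \<longleftrightarrow> z \<notin> edge_of x)"
      using C1[of p] C2[of p] on_edge[of p] t[of p] edge k0 by auto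
  qed
  then have "positioned_arc x k C"
    using k0 k(1) on_edge C1 unfolding positioned_arc_def by blast
  then show ?thesis by blast
qed

lemma arc_exists: "e \<in> edges B \<Longrightarrow> \<exists>C. is_arc e C"
  using arc_positions positioned_arcD(3) unfolding edges_eq by blast

text \<open>On a walk starting at \<open>e\<close>, the second end of \<open>e\<close> comes at
  position \<open>k\<close>, and \<open>C\<close> covers positions \<open>1\<close> to
  \<open>k\<close>. So the sides of \<open>h\<close> join different arcs exactly if \<open>h\<close>
  is met once before and once after \<open>k\<close>.\<close>

lemma interlaced_iff_linked:
  assumes e: "e \<in> edges B" and h: "h \<in> edges B" and neq: "e \<noteq> h"
  shows "interlaced B e h \<longleftrightarrow> linked e h"
proof
  let ?N = "2 * num_edges B"
  assume "linked e h"
  obtain x where x: "x \<in> e" "x \<in> FL" using edge_nonempty[OF e] by blast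
  obtain k C where pos: "positioned_arc x k C" using arc_positions[OF x(2)] by blast
  note k = positioned_arcD(1,2)[OF pos] and C = positioned_arcD(3)[OF pos]
    and on = positioned_arcD(4)[OF pos] and in_C = positioned_arcD(5)[OF pos]
  have e_eq: "e = edge_of x" using edge_eq e x by simp
  have off: "p \<noteq> 0 \<and> p \<noteq> k" if "p < ?N" "(turn ^^ p) x \<in> h" for p
  proof (rule ccontr)
    assume "\<not> ?thesis"
    then have "(turn ^^ p) x \<in> e" using on[OF that(1)] e_eq by simp
    then show False using edges_disjoint[OF e h _ that(2)] neq by simp
  qed
  \<comment> \<open>Every flag of \<open>h\<close> may be replaced by the entry flag of the same
    end: crossing an end of \<open>h\<close> does not change the arc, as \<open>h\<close> differs
    from \<open>e\<close>.\<close>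
  have end_pos: "\<exists>p<?N. (turn ^^ p) x \<in> h \<and> ((turn ^^ p) x \<in> C \<longleftrightarrow> z \<in> C)"
    if z: "z \<in> h" for z
  proof -
    have "z \<in> FL" using edge_subset h z by blast
    then obtain p where p: "p < ?N" "z = (turn ^^ p) x \<or> z = ac ((turn ^^ p) x)"
      using flag_position[OF x(2)] by blast
    let ?u = "(turn ^^ p) x"
    have u: "?u \<in> FL" using x by simp
    have "?u \<in> h" using p(2) z u h by auto
    moreover from this have "?u \<notin> e" using edges_disjoint[OF e h, of ?u] neq by auto
    ultimately show ?thesis
      using p is_arcD(3)[OF C u] e_eq by auto
  qed
  obtain y where y: "y \<in> h" using edge_nonempty[OF h] by blast
  have "(al y \<in> C) \<noteq> (y \<in> C)"
    using linked_iff[OF e h _ y] C e_eq \<open>linked e h\<close> by blast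
  moreover obtain p where p: "p < ?N" "(turn ^^ p) x \<in> h" "(turn ^^ p) x \<in> C \<longleftrightarrow> y \<in> C"
    using end_pos[OF y] by blast
  moreover obtain q where q: "q < ?N" "(turn ^^ q) x \<in> h" "(turn ^^ q) x \<in> C \<longleftrightarrow> al y \<in> C"
    using end_pos[of "al y"] in_edge_maps(2)[OF h y] by blast
  ultimately have "(0 < p \<and> p \<le> k) \<noteq> (0 < q \<and> q \<le> k)" using in_C by blast
  then have "p < k \<and> k < q \<or> q < k \<and> k < p"
    using off[OF p(1,2)] off[OF q(1,2)] by linarith
  then obtain j l where j: "0 < j" "j < k" "(turn ^^ j) x \<in> h"
    and l: "k < l" "l < ?N" "(turn ^^ l) x \<in> h"
    using p q off[OF p(1,2)] off[OF q(1,2)] by (metis gr0I)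
  have "(turn ^^ 0) x \<in> e" "(turn ^^ k) x \<in> e" using x on[of k] k e_eq by auto
  with j l x(2) show "interlaced B e h"
    unfolding interlaced_def turn_eq by blast
next
  let ?N = "2 * num_edges B"
  assume "interlaced B e h"
  then obtain x0 i j m l where x0: "x0 \<in> FL" and lt: "i < j" "j < m" "m < l" "l < ?N"
    and mem: "(turn ^^ i) x0 \<in> e" "(turn ^^ j) x0 \<in> h" "(turn ^^ m) x0 \<in> e" "(turn ^^ l) x0 \<in> h"
    unfolding interlaced_def turn_eq by blast
  \<comment> \<open>Restarting the walk at the first \<open>e\<close> makes position
    \<open>0\<close> an end of \<open>e\<close>, so the other occurrence of \<open>e\<close> must be
    at \<open>k\<close>.\<close>
  define x where "x = (turn ^^ i) x0"
  have x: "x \<in> FL" "x \<in> e" using x0 mem by (simp_all add: x_def)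
  have shift: "(turn ^^ p) x0 = (turn ^^ (p - i)) x" if "i \<le> p" for p
    using that unfolding x_def by (metis comp_apply funpow_add le_add_diff_inverse2)
  obtain k C where pos: "positioned_arc x k C" using arc_positions[OF x(1)] by blast
  note k = positioned_arcD(1,2)[OF pos] and C = positioned_arcD(3)[OF pos]
    and on = positioned_arcD(4)[OF pos] and in_C = positioned_arcD(5)[OF pos]
  have e_eq: "e = edge_of x" using edge_eq e x by simp
  have "m - i = k" using on[of "m - i"] mem(3) shift[of m] lt e_eq by auto
  let ?u = "(turn ^^ (j - i)) x" and ?v = "(turn ^^ (l - i)) x"
  have uv: "?u \<in> h" "?v \<in> h" using mem shift[of j] shift[of l] lt by auto
  then have "?u \<notin> e" "al ?u \<notin> e" using edges_disjoint[OF e h] neq h by (metis in_edge_maps(2))+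
  have FL: "?u \<in> FL" using x by simp
  have "?u \<in> C" "?v \<notin> C"
    using in_C[of "j - i"] in_C[of "l - i"] \<open>m - i = k\<close> lt by auto
  \<comment> \<open>Both \<open>?u\<close> and \<open>ac ?u\<close> lie on \<open>C\<close>, so
    \<open>?v\<close> is \<open>al ?u\<close> or \<open>ac (al ?u)\<close>, and these two flags lie
    on the same arc.\<close>
  have "?v \<in> edge_of ?u" using edge_eq[OF h uv(1)] uv(2) by simp
  then have "?v = ?u \<or> ?v = ac ?u \<or> ?v = al ?u \<or> ?v = ac (al ?u)"
    unfolding edge_of_def by blast
  then have "al ?u \<notin> C"
    using \<open>?u \<in> C\<close> \<open>?v \<notin> C\<close> is_arcD(3)[OF C, of ?u] is_arcD(3)[OF C, of "al ?u"]
      \<open>?u \<notin> e\<close> \<open>al ?u \<notin> e\<close> FL e_eq by auto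
  then show "linked e h"
    using linked_iff[OF e h _ uv(1), of C] C e_eq \<open>?u \<in> C\<close> by blast
qed

text \<open>Starting just behind the first occurrence of \<open>e\<close> moves this occurrence to
  the last position \<open>?N - 1\<close> and turns the pattern into \<open>h e h e\<close>.\<close>

lemma interlaced_sym:
  assumes "interlaced B e h"
  shows "interlaced B h e"
proof -
  let ?N = "2 * num_edges B"
  obtain x i j k l where x: "x \<in> FL" and lt: "i < j" "j < k" "k < l" "l < ?N"
    and mem: "(turn ^^ i) x \<in> e" "(turn ^^ j) x \<in> h" "(turn ^^ k) x \<in> e" "(turn ^^ l) x \<in> h"
    using assms unfolding interlaced_def turn_eq by blast
  define y where "y = (turn ^^ Suc i) x"
  have y: "y \<in> FL" using x unfolding y_def by (rule turn_in)
  have shift: "(turn ^^ (p - Suc i)) y = (turn ^^ p) x" if "i < p" for p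
    using that unfolding y_def by (metis Suc_leI comp_apply funpow_add le_add_diff_inverse2)
  have "(turn ^^ (?N - 1)) y = (turn ^^ i) x"
  proof -
    have "?N - 1 + Suc i = i + ?N" using lt by simp
    then have "(turn ^^ (?N - 1)) y = (turn ^^ (i + ?N)) x"
      unfolding y_def by (metis comp_apply funpow_add)
    also have "\<dots> = (turn ^^ i) x" using turn_period[OF x] by (simp add: funpow_add)
    finally show ?thesis .
  qed
  moreover have "j - Suc i < k - Suc i" "k - Suc i < l - Suc i" "l - Suc i < ?N - 1" "?N - 1 < ?N"
    using lt by auto
  moreover have "(turn ^^ (j - Suc i)) y \<in> h" "(turn ^^ (k - Suc i)) y \<in> e"
    "(turn ^^ (l - Suc i)) y \<in> h"
    using mem shift lt by simp_all
  ultimately show ?thesis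
    using y mem(1) unfolding interlaced_def turn_eq by metis
qed

text \<open>The description by arcs is not visibly symmetric; that by interlacing is.\<close>

lemma linked_sym: "e \<in> edges B \<Longrightarrow> h \<in> edges B \<Longrightarrow> linked e h \<Longrightarrow> linked h e"
  using interlaced_iff_linked interlaced_sym by metis

text \<open>The colour tells whether a fixed direction of travel enters or leaves a ribbon end at
  the flag. \<open>across\<close> and \<open>around\<close> always swap these, and
  \<open>along\<close> does so exactly when the loop is untwisted.\<close>

lemma orientable_if_untwisted:
  assumes "\<And>e. e \<in> edges B \<Longrightarrow> \<not> linked e e"
  shows "orientable B"
proof -
  obtain x where x: "x \<in> FL" using nonempty by blast
  define c where "c z \<longleftrightarrow> (\<exists>p. z = (turn ^^ p) x)" for z
  have ac: "c (ac z) \<longleftrightarrow> \<not> c z" if z: "z \<in> FL" for z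
  proof -
    obtain p where "z = (turn ^^ p) x \<or> z = ac ((turn ^^ p) x)"
      using flag_position[OF x z] by blast
    then show ?thesis
      using turn_neq_across_turn[OF x] x unfolding c_def by (metis flag_maps(2) turn_in)
  qed
  have turn: "c (turn z) \<longleftrightarrow> c z" if z: "z \<in> FL" for z
  proof
    assume "c z"
    then obtain p where "z = (turn ^^ p) x" by (auto simp: c_def)
    then have "turn z = (turn ^^ Suc p) x" by simp
    then show "c (turn z)" unfolding c_def by blast
  next
    assume "c (turn z)"
    then obtain p where p: "turn z = (turn ^^ p) x" by (auto simp: c_def)
    let ?N = "2 * num_edges B"
    have "?N > 0" using flag_position[OF x x] by auto
    then have "p + ?N = Suc (p + ?N - 1)" by simp
    moreover have "(turn ^^ (p + ?N)) x = (turn ^^ p) x"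
      using turn_period[OF x] by (simp add: funpow_add)
    ultimately have "turn z = turn ((turn ^^ (p + ?N - 1)) x)" using p by (metis comp_apply funpow.simps(2))
    then have "z = (turn ^^ (p + ?N - 1)) x"
      using turn_inj[of z "(turn ^^ (p + ?N - 1)) x" 1] z x by simp
    then show "c z" unfolding c_def by blast
  qed
  have turns: "c ((turn ^^ p) z) \<longleftrightarrow> c z" if z: "z \<in> FL" for z p
    by (induction p) (use turn z in auto)
  have ar: "c (ar z) \<longleftrightarrow> \<not> c z" if z: "z \<in> FL" for z
    using turn[of "ac z"] ac[OF z] z by (simp add: turn_def)
  have al: "c (al z) \<longleftrightarrow> \<not> c z" if z: "z \<in> FL" for z
  proof -
    let ?N = "2 * num_edges B"
    obtain k C where pos: "positioned_arc z k C" using arc_positions[OF z] by blast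
    note k = positioned_arcD(1,2)[OF pos] and C = positioned_arcD(3)[OF pos]
      and on = positioned_arcD(4)[OF pos] and in_C = positioned_arcD(5)[OF pos]
    let ?w = "(turn ^^ k) z"
    have w: "?w \<in> FL" "?w \<in> edge_of z" "?w \<in> C" using z on in_C k by auto
    have "z \<notin> C" using in_C[of 0] k by simp
    have e: "edge_of z \<in> edges B" using z by (simp add: edges_eq)
    have "al z \<notin> C"
      using linked_iff[OF e e C edge_of_self] assms[OF e] \<open>z \<notin> C\<close> by blast
    \<comment> \<open>\<open>?w\<close> is the entry flag of the other end of the loop. It lies on
      \<open>C\<close> while \<open>z\<close> and \<open>al z\<close> do not, which leaves one of
      the four flags.\<close>
    have "?w \<noteq> z" using w(3) \<open>z \<notin> C\<close> by metis
    moreover have "?w \<noteq> ac z" by (rule turn_neq_across[OF z])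
    moreover have "?w \<noteq> al z" using w(3) \<open>al z \<notin> C\<close> by metis
    ultimately have "?w = ac (al z)" using w(2) unfolding edge_of_def by blast
    then have "c (ac (al z)) \<longleftrightarrow> c z" using turns[OF z, of k] by simp
    then show ?thesis using ac[OF flag_maps(5)[OF z]] by argo
  qed
  show ?thesis
    unfolding orientable_def by (rule exI[of _ c]) (use ac ar al in blast)
qed

section \<open>Boundary components of spanning ribbon subgraphs\<close>

abbreviation "step \<equiv> boundary_step B"
abbreviation "nf \<equiv> num_boundary_components B"

text \<open>Classes of flags are the boundary components of the spanning subgraph; for
  \<open>A = edges B\<close> they are the faces of \<open>B\<close>.\<close>

definition face :: "'a set set \<Rightarrow> ('a \<times> 'a) set" where
  "face A = reach FL ar (step A)"

lemma in_Union_iff: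
  assumes "A \<subseteq> edges B" "e \<in> edges B" "z \<in> e"
  shows "z \<in> \<Union>A \<longleftrightarrow> e \<in> A"
  using edges_disjoint[OF assms(2) _ assms(3)] assms by blast

lemma step_eq:
  assumes "A \<subseteq> edges B" "e \<in> edges B" "z \<in> e"
  shows "step A z = (if e \<in> A then al z else ac z)"
  using in_Union_iff[OF assms] by (simp add: boundary_step_def)

lemma step_involution:
  assumes "A \<subseteq> edges B"
  shows "free_involution_on FL (step A)"
  unfolding free_involution_on_def
proof
  fix z assume z: "z \<in> FL"
  have e: "edge_of z \<in> edges B" using z by (simp add: edges_eq)
  have st: "step A w = (if edge_of z \<in> A then al w else ac w)" if "w \<in> edge_of z" for w
    using step_eq[OF assms e that] .
  have "ac z \<in> edge_of z" "al z \<in> edge_of z" by (simp_all add: edge_of_def)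
  then show "step A z \<in> FL \<and> step A (step A z) = z \<and> step A z \<noteq> z"
    using z st[of z] st[of "al z"] st[of "ac z"] by auto
qed

lemma equiv_face: "A \<subseteq> edges B \<Longrightarrow> equiv UNIV (face A)"
  unfolding face_def by (rule equiv_reach[OF involutions(3) step_involution])

lemma face_sym: "A \<subseteq> edges B \<Longrightarrow> (x, y) \<in> face A \<Longrightarrow> (y, x) \<in> face A"
  unfolding face_def by (rule reach_sym[OF involutions(3) step_involution])

lemma face_trans: "(x, y) \<in> face A \<Longrightarrow> (y, z) \<in> face A \<Longrightarrow> (x, z) \<in> face A"
  unfolding face_def by (rule reach_trans)

lemma face_around: "x \<in> FL \<Longrightarrow> (x, ar x) \<in> face A"
  unfolding face_def by (rule reach_step1)

lemma face_step: "x \<in> FL \<Longrightarrow> (x, step A x) \<in> face A"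
  unfolding face_def by (rule reach_step2)

lemma face_refl [simp]: "(x, x) \<in> face A"
  by (simp add: face_def)

lemma face_along: "A \<subseteq> edges B \<Longrightarrow> e \<in> A \<Longrightarrow> z \<in> e \<Longrightarrow> (z, al z) \<in> face A"
  using face_step[of z A] step_eq[of A e z] edge_subset[of e] by (auto simp: subset_iff)

lemma nf_eq: "nf A = card (FL // face A)"
  by (simp add: num_boundary_components_def isolated_eq_0 orbits_of_reach face_def)

lemma one_face_iff:
  assumes "A \<subseteq> edges B"
  shows "nf A = 1 \<longleftrightarrow> (\<forall>x\<in>FL. \<forall>y\<in>FL. (x, y) \<in> face A)"
  unfolding nf_eq face_def orbits_of_reach[symmetric]
  by (rule one_orbit_iff[OF involutions(3) step_involution[OF assms] nonempty])

lemma one_face_empty: "nf {} = 1"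
proof -
  have "step {} = ac" by (auto simp: boundary_step_def)
  then show ?thesis
    using connected by (simp add: one_face_iff face_def del: One_nat_def)
qed

lemma face_class_closed:
  assumes "A \<subseteq> edges B" "S = {z \<in> FL. (x, z) \<in> face A}" "z \<in> FL"
  shows "ar z \<in> S \<longleftrightarrow> z \<in> S" "step A z \<in> S \<longleftrightarrow> z \<in> S"
proof -
  have st: "step A z \<in> FL"
    using step_involution[OF assms(1)] assms(3) by (simp add: free_involution_on_def)
  have "(z, ar z) \<in> face A" "(ar z, z) \<in> face A"
    using face_around[OF assms(3), of A] face_sym[OF assms(1)] by simp_all
  then show "ar z \<in> S \<longleftrightarrow> z \<in> S"
    unfolding assms(2) using assms(3) face_trans[of x _ A] by auto
  have "(z, step A z) \<in> face A" "(step A z, z) \<in> face A"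
    using face_step[OF assms(3), of A] face_sym[OF assms(1)] by simp_all
  then show "step A z \<in> S \<longleftrightarrow> z \<in> S"
    unfolding assms(2) using assms(3) st face_trans[of x _ A] by auto
qed

subsection \<open>Adding and deleting edges\<close>

text \<open>Old and new boundary walks differ only at the four flags of \<open>e\<close>, which lie
  in at most two of the new faces, one for each side of \<open>e\<close>.\<close>

lemma nf_insert_le:
  assumes A: "A \<subseteq> edges B" and e: "e \<in> edges B" "e \<notin> A"
  shows "nf (insert e A) \<le> nf A + 1"
proof -
  let ?A' = "insert e A"
  have A': "?A' \<subseteq> edges B" using A e by blast
  obtain y where y: "y \<in> e" "y \<in> FL" using edge_nonempty[OF e(1)] by blast
  \<comment> \<open>The new faces at the two sides of \<open>e\<close>. An old face either stays
    inside one new face or lies entirely in this union.\<close>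
  define U where "U = {u. (y, u) \<in> face ?A' \<or> (ac y, u) \<in> face ?A'}"
  have U: "v \<in> U \<longleftrightarrow> u \<in> U" if "(u, v) \<in> face ?A'" for u v
    using that face_trans face_sym[OF A'] unfolding U_def by blast
  have "y \<in> U" "ac y \<in> U" by (simp_all add: U_def)
  moreover have "al y \<in> U"
    using U[OF face_along[OF A' insertI1 y(1)]] \<open>y \<in> U\<close> by simp
  moreover have "ac y \<in> e" using e(1) y(1) by simp
  then have "al (ac y) \<in> U"
    using U[OF face_along[OF A' insertI1]] \<open>ac y \<in> U\<close> by simp
  moreover have "e = {y, ac y, al y, ac (al y)}"
    using edge_eq[OF e(1) y(1)] by (simp add: edge_of_def)
  ultimately have e_U: "e \<subseteq> U" using y(2) by simp
  have *: "(u, v) \<in> face ?A' \<or> u \<in> U \<and> v \<in> U" if "(u, v) \<in> face A" for u v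
  proof -
    have "v \<in> {v. (u, v) \<in> face ?A' \<or> u \<in> U \<and> v \<in> U}"
      using that unfolding face_def[of A]
    proof (rule reach_closed)
      show "u \<in> {v. (u, v) \<in> face ?A' \<or> u \<in> U \<and> v \<in> U}" by simp
    next
      fix z assume z: "z \<in> {v. (u, v) \<in> face ?A' \<or> u \<in> U \<and> v \<in> U}" "z \<in> FL"
      show "ar z \<in> {v. (u, v) \<in> face ?A' \<or> u \<in> U \<and> v \<in> U}"
        using z(1) face_around[OF z(2), of ?A'] U face_trans by blast
      show "step A z \<in> {v. (u, v) \<in> face ?A' \<or> u \<in> U \<and> v \<in> U}"
      proof (cases "z \<in> e")
        case True
        then have "step A z \<in> e" using step_eq[OF A e(1) True] e by simp
        moreover have "u \<in> U" using z(1) U True e_U by blast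
        ultimately show ?thesis using e_U by blast
      next
        case False
        then have "step A z = step ?A' z" by (simp add: boundary_step_def)
        then have "(z, step A z) \<in> face ?A'" using face_step[OF z(2), of ?A'] by simp
        then show ?thesis using z(1) U face_trans by blast
      qed
    qed
    then show ?thesis by blast
  qed
  have "card (FL // face ?A') \<le> card (FL // face A) + 1"
  proof (rule card_quotient_merge[OF finite_flags equiv_face[OF A'] equiv_face[OF A] y(2)])
    show "(u, v) \<in> face ?A' \<or> ((y, u) \<in> face ?A' \<or> (ac y, u) \<in> face ?A') \<and>
        ((y, v) \<in> face ?A' \<or> (ac y, v) \<in> face ?A')" if "(u, v) \<in> face A" for u v
      using *[OF that] unfolding U_def by simp
  qed
  then show ?thesis by (simp add: nf_eq)
qed

text \<open>Edges are added to the single vertex one by one. The bound makes the Euler genera of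
  partial duals non-negative, so \<open>nat\<close> truncates nothing.\<close>

lemma nf_le_card: "A \<subseteq> edges B \<Longrightarrow> nf A \<le> card A + 1"
proof -
  assume A: "A \<subseteq> edges B"
  then have "finite A" using finite_edges finite_subset by blast
  then show ?thesis using A
  proof (induction A rule: finite_induct)
    case empty
    then show ?case using one_face_empty by simp
  next
    case (insert e A)
    then show ?case using nf_insert_le[of A e] by simp
  qed
qed

text \<open>
  If the sides of \<open>e\<close> lie in different faces, then deleting \<open>e\<close> merges these. That neither of them
  falls apart is a parity argument: otherwise one part of the first face would be matched by
  \<open>around\<close>, and with the flag \<open>y\<close> removed by \<open>step\<close>.
\<close>

lemma nf_delete_less:
  assumes A: "A \<subseteq> edges B" and e: "e \<in> A" "y \<in> e" and no: "(y, ac y) \<notin> face A"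
  shows "nf (A - {e}) < nf A"
proof -
  let ?A' = "A - {e}"
  have A': "?A' \<subseteq> edges B" and eB: "e \<in> edges B" using A e by auto
  have y: "y \<in> FL" using edge_subset[OF eB] e by blast
  have e_eq: "e = {y, ac y, al y, ac (al y)}"
    using edge_eq[OF eB e(2)] by (simp add: edge_of_def)
  have step_off: "step ?A' z = step A z" if "z \<notin> e" for z
    using that by (auto simp: boundary_step_def)
  have step_on: "step ?A' z = ac z" "step A z = al z" if "z \<in> e" for z
    using step_eq[OF A' eB that] step_eq[OF A eB that] e by simp_all
  have y_al: "(y, al y) \<in> face ?A'"
  proof (rule ccontr)
    assume not: "(y, al y) \<notin> face ?A'"
    \<comment> \<open>\<open>T \<inter> P\<close> is the part of the old face that stays with
      \<open>y\<close> after the deletion; off \<open>e\<close> the old and the new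
      \<open>step\<close> agree.\<close>
    define T where "T = {z \<in> FL. (y, z) \<in> face ?A'}"
    define P where "P = {z \<in> FL. (y, z) \<in> face A}"
    note T = face_class_closed[OF A' T_def] and P = face_class_closed[OF A P_def]
    have "al y \<notin> T" using not by (simp add: T_def)
    have "ac y \<notin> P" using no by (simp add: P_def)
    have "ac (al y) \<notin> P"
      using P(2)[of "ac y"] step_on(2)[of "ac y"] e_eq y \<open>ac y \<notin> P\<close> by simp
    have "y \<in> T \<inter> P" using y by (simp add: T_def P_def)
    have on_e: "z = y" if "z \<in> T \<inter> P" "z \<in> e" for z
      using that e_eq \<open>al y \<notin> T\<close> \<open>ac y \<notin> P\<close> \<open>ac (al y) \<notin> P\<close> by blast
    have fin: "finite (T \<inter> P)" using finite_flags by (simp add: T_def)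
    have TP: "T \<inter> P \<subseteq> FL" by (auto simp: T_def)
    have "free_involution_on (T \<inter> P) ar"
      unfolding free_involution_on_def
    proof
      fix z assume z: "z \<in> T \<inter> P"
      then have "z \<in> FL" using TP by blast
      then show "ar z \<in> T \<inter> P \<and> ar (ar z) = z \<and> ar z \<noteq> z" using z T(1) P(1) by simp
    qed
    then have even: "even (card (T \<inter> P))" by (rule even_card_free_involution[OF fin])
    have "free_involution_on (T \<inter> P - {y}) (step A)"
      unfolding free_involution_on_def
    proof
      fix z assume z: "z \<in> T \<inter> P - {y}"
      then have z': "z \<notin> e" "z \<in> FL" using on_e TP by blast+
      have inv: "step A z \<in> FL" "step A (step A z) = z" "step A z \<noteq> z"
        using step_involution[OF A] z'(2) by (simp_all add: free_involution_on_def)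
      have "step A z \<noteq> y"
      proof
        assume "step A z = y"
        then have "z = step A y" using inv by simp
        then have "z = al y" using step_on(2)[of y] e by simp
        then show False using z' e_eq by blast
      qed
      then show "step A z \<in> T \<inter> P - {y} \<and> step A (step A z) = z \<and> step A z \<noteq> z"
        using z T(2)[OF z'(2)] P(2)[OF z'(2)] inv step_off[OF z'(1)] by simp
    qed
    then have "even (card (T \<inter> P - {y}))"
      using fin by (intro even_card_free_involution) auto
    moreover have "card (T \<inter> P) = Suc (card (T \<inter> P - {y}))"
      using \<open>y \<in> T \<inter> P\<close> fin by (metis card.remove)
    ultimately show False using even by simp
  qed
  have acr: "(z, ac z) \<in> face ?A'" if "z \<in> e" for z
    using face_step[of z ?A'] step_on(1)[OF that] that edge_subset[OF eB] by auto
  have in_e: "y \<in> e" "ac y \<in> e" "al y \<in> e" "ac (al y) \<in> e" using e_eq by blast+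
  \<comment> \<open>After the deletion \<open>across\<close> joins the two flags of each end, and
    \<open>y_al\<close> joins the two ends. So every old face lies inside a new one.\<close>
  have y_all: "(y, z) \<in> face ?A'" if "z \<in> e" for z
  proof -
    have "(y, ac y) \<in> face ?A'" "(y, ac (al y)) \<in> face ?A'"
      using acr[OF in_e(1)] face_trans[OF y_al acr[OF in_e(3)]] by simp_all
    then show ?thesis using that e_eq y_al by auto
  qed
  have "face A \<subseteq> face ?A'"
    unfolding face_def[of A]
    unfolding face_def
  proof (rule reach_subset, fold face_def)
    fix z assume z: "z \<in> FL"
    show "(z, ar z) \<in> face ?A'" by (rule face_around[OF z])
    show "(z, step A z) \<in> face ?A'"
    proof (cases "z \<in> e")
      case True
      then have "step A z \<in> e" using step_on(2) eB by simp
      then show ?thesis using y_all True face_sym[OF A'] face_trans by blast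
    next
      case False
      then show ?thesis using face_step[OF z, of ?A'] step_off by simp
    qed
  qed
  then show ?thesis
    unfolding nf_eq
    using card_quotient_strict[OF finite_flags equiv_face[OF A] equiv_face[OF A'], of y "ac y"]
      y no y_all[OF in_e(2)] by simp
qed

text \<open>The deletion replaces \<open>along\<close> by \<open>across\<close> on \<open>e\<close>,
  and by assumption \<open>across\<close> does not leave the old face. So old faces can only be
  subdivided.\<close>

lemma face_delete_subset:
  assumes A: "A \<subseteq> edges B" and e: "e \<in> A" and flat: "\<And>y. y \<in> e \<Longrightarrow> (y, ac y) \<in> face A"
  shows "face (A - {e}) \<subseteq> face A"
  unfolding face_def
proof (rule reach_subset, fold face_def)
  fix z assume z: "z \<in> FL"
  show "(z, ar z) \<in> face A" by (rule face_around[OF z])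
  show "(z, step (A - {e}) z) \<in> face A"
  proof (cases "z \<in> e")
    case True
    then have "step (A - {e}) z = ac z"
      using step_eq[of "A - {e}" e z] A e by auto
    then show ?thesis using flat[OF True] by simp
  next
    case False
    then have "step (A - {e}) z = step A z" by (auto simp: boundary_step_def)
    then show ?thesis using face_step[OF z, of A] by simp
  qed
qed

subsection \<open>Faces and the kernel of the adjacency matrix\<close>

definition bent :: "'a set \<Rightarrow> 'a set \<Rightarrow> bool" where
  "bent S h \<longleftrightarrow> (\<exists>y\<in>h. (ac y \<in> S) \<noteq> (y \<in> S))"

lemma odd_card_Int_edge:
  assumes "y \<in> FL"
  shows "odd (card (T \<inter> edge_of y)) \<longleftrightarrow>
    ((y \<in> T) \<noteq> (ac y \<in> T)) \<noteq> ((al y \<in> T) \<noteq> (ac (al y) \<in> T))"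
proof -
  have "ac (al y) \<noteq> y" "ac (al y) \<noteq> ac y" using assms flag_maps by metis+
  then have neq: "y \<noteq> ac (al y)" "ac y \<noteq> ac (al y)" by metis+
  have "card (T \<inter> edge_of y) = card ({z \<in> edge_of y. z \<in> T})"
    by (rule arg_cong[of _ _ card]) blast
  also have "\<dots> = (\<Sum>z\<in>edge_of y. if z \<in> T then 1 else 0)"
    by (simp add: edge_of_def sum.If_cases Int_def)
  also have "\<dots> = of_bool (y \<in> T) + of_bool (ac y \<in> T) + of_bool (al y \<in> T) + of_bool (ac (al y) \<in> T)"
    using assms neq by (simp add: edge_of_def)
  finally show ?thesis by simp
qed

text \<open>
  The edges of \<open>A\<close> that have exactly one of their two sides in a union of faces form a vector in the
  kernel of the submatrix with index set \<open>A\<close>: count the flags of \<open>S\<close> on an arc of \<open>e\<close> first by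
  \<open>around\<close>, then edge by edge.
\<close>

lemma even_card_linked_bent:
  assumes A: "A \<subseteq> edges B" and e: "e \<in> A"
    and ar: "\<And>z. z \<in> FL \<Longrightarrow> ar z \<in> S \<longleftrightarrow> z \<in> S"
    and st: "\<And>z. z \<in> FL \<Longrightarrow> step A z \<in> S \<longleftrightarrow> z \<in> S"
  shows "even (card {h \<in> A. linked e h \<and> bent S h})"
proof -
  have eB: "e \<in> edges B" using A e by blast
  obtain C where C: "is_arc e C" using arc_exists[OF eB] by blast
  have CFL: "C \<subseteq> FL" by (rule is_arcD(1)[OF C])
  have "free_involution_on (C \<inter> S) ar"
    unfolding free_involution_on_def
  proof
    fix z assume z: "z \<in> C \<inter> S"
    then have "z \<in> FL" using CFL by blast
    then show "ar z \<in> C \<inter> S \<and> ar (ar z) = z \<and> ar z \<noteq> z"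
      using z ar is_arcD(2)[OF C] by simp
  qed
  then have "even (card (C \<inter> S))"
    using CFL finite_flags by (intro even_card_free_involution) (auto intro: finite_subset)
  also have "card (C \<inter> S) = (\<Sum>h\<in>edges B. card (C \<inter> S \<inter> h))"
  proof -
    have "C \<inter> S = (\<Union>h\<in>edges B. C \<inter> S \<inter> h)" using CFL Union_edges by blast
    then have "card (C \<inter> S) = card (\<Union>h\<in>edges B. C \<inter> S \<inter> h)" by simp
    also have "\<dots> = (\<Sum>h\<in>edges B. card (C \<inter> S \<inter> h))"
    proof (rule card_UN_disjoint[OF finite_edges])
      show "\<forall>h\<in>edges B. finite (C \<inter> S \<inter> h)"
        using finite_subset[OF CFL finite_flags] by simp
      show "\<forall>h\<in>edges B. \<forall>h'\<in>edges B. h \<noteq> h' \<longrightarrow> C \<inter> S \<inter> h \<inter> (C \<inter> S \<inter> h') = {}"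
        using edges_disjoint by blast
    qed
    finally show ?thesis .
  qed
  finally have "even (card {h \<in> edges B. odd (card (C \<inter> S \<inter> h))})"
    by (simp only: even_sum_iff[OF finite_edges])
  also have "{h \<in> edges B. odd (card (C \<inter> S \<inter> h))} = {h \<in> A. linked e h \<and> bent S h}"
  proof -
    have "odd (card (C \<inter> S \<inter> h)) \<longleftrightarrow> h \<in> A \<and> linked e h \<and> bent S h" if h: "h \<in> edges B" for h
    proof -
      obtain y where y: "y \<in> h" "y \<in> FL" using edge_nonempty[OF h] by blast
      have h_eq: "h = {y, ac y, al y, ac (al y)}" and h_of: "h = edge_of y"
        using edge_eq[OF h y(1)] by (simp_all add: edge_of_def)
      have odd: "odd (card (C \<inter> S \<inter> h)) \<longleftrightarrow>
          ((y \<in> C \<inter> S) \<noteq> (ac y \<in> C \<inter> S)) \<noteq> ((al y \<in> C \<inter> S) \<noteq> (ac (al y) \<in> C \<inter> S))"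
        unfolding h_of by (rule odd_card_Int_edge[OF y(2)])
      have in_e: "y \<in> e \<longleftrightarrow> h = e" "al y \<in> e \<longleftrightarrow> h = e"
        using edges_disjoint[OF h eB y(1)] y eB by auto
      have acC: "ac y \<in> C \<longleftrightarrow> (y \<in> C \<longleftrightarrow> h \<noteq> e)" "ac (al y) \<in> C \<longleftrightarrow> (al y \<in> C \<longleftrightarrow> h \<noteq> e)"
        using is_arcD(3)[OF C y(2)] is_arcD(3)[OF C, of "al y"] in_e y(2) by auto
      have linked: "linked e h \<longleftrightarrow> (al y \<in> C) \<noteq> (y \<in> C)" by (rule linked_iff[OF eB h C y(1)])
      have in_h: "y \<in> h" "ac y \<in> h" "al y \<in> h" using h_eq by blast+
      \<comment> \<open>For \<open>h\<close> in \<open>A\<close> the set \<open>S\<close> contains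
        whole sides; each side has an odd number of flags on \<open>C\<close> iff \<open>e\<close>
        and \<open>h\<close> are linked, so two sides in \<open>S\<close> cancel. For
        \<open>h\<close> outside \<open>A\<close>, \<open>across\<close> preserves both
        \<open>C\<close> and \<open>S\<close>, so its flags pair up.\<close>
      show ?thesis
      proof (cases "h \<in> A")
        case True
        have "al y \<in> S \<longleftrightarrow> y \<in> S" "ac (al y) \<in> S \<longleftrightarrow> ac y \<in> S"
          using st[of y] st[of "ac y"] step_eq[OF A h in_h(1)] step_eq[OF A h in_h(2)] True y(2)
          by simp_all
        moreover from this have "bent S h \<longleftrightarrow> (ac y \<in> S) \<noteq> (y \<in> S)"
          unfolding bent_def h_eq using y(2) by auto
        ultimately show ?thesis
          unfolding odd linked Int_iff acC using True
          by (cases "y \<in> C"; cases "al y \<in> C"; cases "h = e"; cases "y \<in> S"; simp)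
      next
        case False
        then have "h \<noteq> e" using e by blast
        have "ac y \<in> S \<longleftrightarrow> y \<in> S" "ac (al y) \<in> S \<longleftrightarrow> al y \<in> S"
          using st[of y] st[of "al y"] step_eq[OF A h in_h(1)] step_eq[OF A h in_h(3)] False y(2)
          by simp_all
        then show ?thesis unfolding odd Int_iff acC using False \<open>h \<noteq> e\<close> by simp
      qed
    qed
    then show ?thesis using A by blast
  qed
  finally show ?thesis .
qed

text \<open>The edges bent by a single face \<open>S\<close> form a kernel vector, hence there are
  none. Then \<open>S\<close> is closed under \<open>across\<close> too, and contains all
  flags.\<close>

lemma one_face_if_trivial_kernel:
  assumes A: "A \<subseteq> edges B"
    and ker: "\<And>X. X \<subseteq> A \<Longrightarrow> (\<And>e. e \<in> A \<Longrightarrow> even (card {h \<in> X. linked e h})) \<Longrightarrow> X = {}"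
  shows "nf A = 1"
  unfolding one_face_iff[OF A]
proof (intro ballI)
  fix x y assume x: "x \<in> FL" and y: "y \<in> FL"
  define S where "S = {z \<in> FL. (x, z) \<in> face A}"
  note S = face_class_closed[OF A S_def]
  have "{h \<in> A. bent S h} = {}"
  proof (rule ker)
    fix e assume e: "e \<in> A"
    have "{h \<in> {h \<in> A. bent S h}. linked e h} = {h \<in> A. linked e h \<and> bent S h}" by blast
    then show "even (card {h \<in> {h \<in> A. bent S h}. linked e h})"
      using even_card_linked_bent[OF A e S] by simp
  qed blast
  then have flat: "\<not> bent S h" if "h \<in> A" for h using that by blast
  have "S = FL"
  proof (rule closed_eq_flags)
    show "S \<subseteq> FL" "x \<in> S" using x by (auto simp: S_def)
    fix z assume z: "z \<in> S"
    then have zF: "z \<in> FL" by (simp add: S_def)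
    show "ar z \<in> S" using S(1)[OF zF] z by simp
    have e: "edge_of z \<in> edges B" using zF by (simp add: edges_eq)
    show "ac z \<in> S"
    proof (cases "edge_of z \<in> A")
      case True
      then show ?thesis using flat[OF True] z edge_of_self unfolding bent_def by blast
    next
      case False
      then show ?thesis using S(2)[OF zF] z step_eq[OF A e edge_of_self] by simp
    qed
  qed
  then show "(x, y) \<in> face A" using y unfolding S_def by blast
qed

section \<open>Bouquets whose partial duals all have the same Euler genus\<close>

lemma nf_pos: "nf A \<ge> 1"
proof -
  have "FL // face A \<noteq> {}" "finite (FL // face A)"
    using nonempty finite_flags by (simp_all add: quotient_def)
  then have "card (FL // face A) > 0" by (simp add: card_gt_0_iff)
  then show ?thesis by (simp add: nf_eq)
qed

text \<open>An induced path in the intersection graph whose only twisted loop is the first edge; the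
  case \<open>i = 0 \<and> j = 0\<close> is the corresponding diagonal entry of the matrix.\<close>

definition loop_path :: "nat \<Rightarrow> (nat \<Rightarrow> 'a set) \<Rightarrow> bool" where
  "loop_path n v \<longleftrightarrow> (\<forall>i\<le>n. v i \<in> edges B) \<and> inj_on v {..n} \<and>
     (\<forall>i\<le>n. \<forall>j\<le>n. linked (v i) (v j) \<longleftrightarrow> j = Suc i \<or> i = Suc j \<or> i = 0 \<and> j = 0)"

lemma loop_pathD:
  assumes "loop_path n v"
  shows "i \<le> n \<Longrightarrow> v i \<in> edges B" "inj_on v {..n}"
    "i \<le> n \<Longrightarrow> j \<le> n \<Longrightarrow> linked (v i) (v j) \<longleftrightarrow> j = Suc i \<or> i = Suc j \<or> i = 0 \<and> j = 0"
  using assms unfolding loop_path_def by blast+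

lemma loop_path_prefix: "loop_path n v \<Longrightarrow> m \<le> n \<Longrightarrow> loop_path m v"
  unfolding loop_path_def by (auto intro: inj_on_subset)

text \<open>
  The submatrix of a path, with a single diagonal entry 1 at an extremity, is nonsingular.
\<close>

lemma one_face_path:
  assumes path: "loop_path n v"
  shows "nf (v ` {..n}) = 1"
proof (rule one_face_if_trivial_kernel)
  note v = loop_pathD(1)[OF path]
  show "v ` {..n} \<subseteq> edges B" using v by auto
next
  note inj = loop_pathD(2)[OF path] and link = loop_pathD(3)[OF path]
  fix X assume X: "X \<subseteq> v ` {..n}"
    and ev: "\<And>e. e \<in> v ` {..n} \<Longrightarrow> even (card {h \<in> X. linked e h})"
  define I where "I = {i. i \<le> n \<and> v i \<in> X}"
  have row: "even (card {j \<in> I. j = Suc i \<or> i = Suc j \<or> i = 0 \<and> j = 0})" if i: "i \<le> n" for i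
  proof -
    let ?J = "{j \<in> I. j = Suc i \<or> i = Suc j \<or> i = 0 \<and> j = 0}"
    have "{h \<in> X. linked (v i) h} = v ` ?J"
    proof (intro equalityI subsetI)
      fix h assume h: "h \<in> {h \<in> X. linked (v i) h}"
      then obtain j where j: "j \<le> n" "h = v j" using X by blast
      then have "j \<in> ?J" using h link[OF i j(1)] by (simp add: I_def)
      then show "h \<in> v ` ?J" using j(2) by blast
    next
      fix h assume "h \<in> v ` ?J"
      then obtain j where j: "j \<in> ?J" "h = v j" by blast
      then show "h \<in> {h \<in> X. linked (v i) h}" using link[OF i, of j] by (simp add: I_def)
    qed
    moreover have "inj_on v ?J" using inj by (rule inj_on_subset) (auto simp: I_def)
    ultimately have "card {h \<in> X. linked (v i) h} = card ?J" by (simp add: card_image)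
    then show ?thesis using ev[of "v i"] i by simp
  qed
  have pair: "a \<in> I \<longleftrightarrow> b \<in> I" if "even (card {j \<in> I. j = a \<or> j = b})" "a \<noteq> b" for a b
  proof (rule ccontr)
    assume "\<not> (a \<in> I \<longleftrightarrow> b \<in> I)"
    then have "{j \<in> I. j = a \<or> j = b} = {a} \<or> {j \<in> I. j = a \<or> j = b} = {b}" by blast
    then have "card {j \<in> I. j = a \<or> j = b} = 1" by (elim disjE) simp_all
    with that(1) show False by simp
  qed
  \<comment> \<open>Row \<open>0\<close>, with its diagonal entry, equates the coordinates
    \<open>0\<close> and \<open>1\<close>; row \<open>m + 1\<close> equates \<open>m\<close> and
    \<open>m + 2\<close>.\<close>
  have all: "i \<le> n \<Longrightarrow> i \<in> I \<longleftrightarrow> 0 \<in> I" for i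
  proof (induction i rule: less_induct)
    case (less i)
    consider "i = 0" | "i = 1" | m where "i = Suc (Suc m)"
      by (metis One_nat_def not0_implies_Suc)
    then show ?case
    proof cases
      case 2
      have "{j \<in> I. j = Suc 0 \<or> 0 = Suc j \<or> 0 = 0 \<and> j = 0} = {j \<in> I. j = 1 \<or> j = 0}" by auto
      then show ?thesis using row[of 0] pair[of 1 0] 2 by simp
    next
      case 3
      have "{j \<in> I. j = Suc (Suc m) \<or> Suc m = Suc j \<or> Suc m = 0 \<and> j = 0}
          = {j \<in> I. j = i \<or> j = m}" using 3 by auto
      then have "i \<in> I \<longleftrightarrow> m \<in> I" using row[of "Suc m"] pair[of i m] 3 less.prems by simp
      then show ?thesis using less.IH[of m] 3 less.prems by simp
    qed simp
  qed
  have "0 \<notin> I"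
  proof
    assume "0 \<in> I"
    then have I: "i \<in> I \<longleftrightarrow> i \<le> n" for i using all[of i] by (auto simp: I_def)
    \<comment> \<open>The last row has a single entry, so the constant vector 1 is not in the
      kernel. For \<open>n = 0\<close> the truncated \<open>n - 1\<close> is \<open>0\<close>, the
      diagonal entry.\<close>
    have "{j \<in> I. j = Suc n \<or> n = Suc j \<or> n = 0 \<and> j = 0} = {n - 1}"
      unfolding I by (cases n) auto
    then show False using row[of n] by simp
  qed
  then have "I = {}" using all by (auto simp: I_def)
  then show "X = {}" using X by (auto simp: I_def)
qed

lemma one_face_twisted_loop:
  assumes "e \<in> edges B" "linked e e"
  shows "nf {e} = 1"
  using one_face_path[of 0 "\<lambda>_. e"] assms by (simp add: loop_path_def)

text \<open>Initial segments have one face, so by \<open>const\<close> their complements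
  \<open>D i\<close> all have as many faces as \<open>B\<close>. Each deletion is therefore flat
  within \<open>D i\<close>, and \<open>face_delete_subset\<close> carries this back to all
  edges.\<close>

lemma path_end_flat:
  assumes path: "loop_path n v"
    and const: "\<And>A. A \<subseteq> edges B \<Longrightarrow> nf A + nf (edges B - A) = nf (edges B) + 1"
    and y: "y \<in> v n"
  shows "(y, ac y) \<in> face (edges B)"
proof -
  note v = loop_pathD(1)[OF path] and inj = loop_pathD(2)[OF path]
  define D where "D i = edges B - v ` {..<i}" for i
  have one: "nf (v ` {..<i}) = 1" if i: "i \<le> Suc n" for i
  proof (cases i)
    case 0
    then show ?thesis using one_face_empty by simp
  next
    case (Suc m)
    then have m: "m \<le> n" using i by simp
    have "nf (v ` {..m}) = 1" by (rule one_face_path[OF loop_path_prefix[OF path m]])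
    then show ?thesis using Suc by (simp add: lessThan_Suc_atMost)
  qed
  have D: "D i \<subseteq> edges B" for i by (auto simp: D_def)
  have nf_D: "nf (D i) = nf (edges B)" if i: "i \<le> Suc n" for i
  proof -
    have "v ` {..<i} \<subseteq> edges B" using v i by auto
    then show ?thesis using const[of "v ` {..<i}"] one[OF i] by (simp add: D_def)
  qed
  have D_Suc: "D (Suc i) = D i - {v i}" for i
    by (auto simp: D_def lessThan_Suc)
  have v_D: "v i \<in> D i" if "i \<le> n" for i
  proof -
    have "v i \<notin> v ` {..<i}"
    proof
      assume "v i \<in> v ` {..<i}"
      then obtain j where "j < i" "v i = v j" by blast
      then show False using inj_onD[OF inj, of i j] that by simp
    qed
    then show ?thesis using v[OF that] by (simp add: D_def)
  qed
  have flat: "(z, ac z) \<in> face (D i)" if i: "i \<le> n" and z: "z \<in> v i" for i z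
  proof (rule ccontr)
    assume "(z, ac z) \<notin> face (D i)"
    from nf_delete_less[OF D v_D[OF i] z this] show False
      using nf_D[of i] nf_D[of "Suc i"] i D_Suc by simp
  qed
  have "i \<le> Suc n \<Longrightarrow> face (D i) \<subseteq> face (edges B)" for i
  proof (induction i)
    case 0
    then show ?case by (simp add: D_def)
  next
    case (Suc i)
    have "face (D (Suc i)) \<subseteq> face (D i)"
      unfolding D_Suc by (rule face_delete_subset[OF D v_D]) (use Suc.prems flat in auto)
    then show ?case using Suc by auto
  qed
  from this[of n] flat[of n y] y show ?thesis by auto
qed

section \<open>Distances to the twisted loops in the intersection graph\<close>

definition link_rel :: "('a set \<times> 'a set) set" where
  "link_rel = {(e, h). e \<in> edges B \<and> h \<in> edges B \<and> e \<noteq> h \<and> linked e h}"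

text \<open>Connectedness of a digraph is strong connectedness of its symmetric closure, and
  \<open>link_rel\<close> is symmetric already.\<close>

lemma link_rel_connected:
  assumes "Digraph_Component.connected (with_proj (intersection_graph B))"
    and "e \<in> edges B" "h \<in> edges B"
  shows "(e, h) \<in> link_rel\<^sup>*"
proof -
  let ?G = "mk_symmetric (with_proj (intersection_graph B))"
  have "parcs (intersection_graph B) \<subseteq> link_rel"
    using interlaced_iff_linked by (auto simp: intersection_graph_def link_rel_def)
  moreover have "link_rel\<inverse> \<subseteq> link_rel"
    using linked_sym by (auto simp: link_rel_def)
  ultimately have sub: "parcs ?G \<subseteq> link_rel"
    unfolding parcs_mk_symmetric with_proj_simps by fastforce
  have "pverts ?G = edges B" by (simp add: intersection_graph_def)
  then have "e \<rightarrow>\<^sup>*\<^bsub>?G\<^esub> h"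
    using assms unfolding connected_def strongly_connected_def by simp
  then have "(e, h) \<in> rtrancl_on (pverts ?G) (parcs ?G)"
    by (simp only: reachable_def with_proj_simps)
  then have "(e, h) \<in> (parcs ?G)\<^sup>*" by (rule rtrancl_on_rtranclI)
  then show ?thesis using rtrancl_mono[OF sub] by blast
qed

text \<open>A shortest path from a twisted loop to \<open>g\<close> is an induced path with no further twisted loop.\<close>

lemma shortest_path:
  assumes conn: "\<And>e h. e \<in> edges B \<Longrightarrow> h \<in> edges B \<Longrightarrow> (e, h) \<in> link_rel\<^sup>*"
    and e0: "e0 \<in> edges B" "linked e0 e0" and g: "g \<in> edges B"
  shows "\<exists>n v. loop_path n v \<and> v n = g"
proof -
  \<comment> \<open>\<open>P h m\<close>: a walk of length \<open>m\<close> leads from some twisted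
    loop to \<open>h\<close>. So \<open>d\<close> is the distance from the set of all twisted loops,
    and the path may start at another one than \<open>e0\<close>.\<close>
  define P where "P h m \<longleftrightarrow> (\<exists>e\<in>edges B. linked e e \<and> (e, h) \<in> link_rel ^^ m)" for h m
  define d where "d h = (LEAST m. P h m)" for h
  have P_ex: "\<exists>m. P h m" if "h \<in> edges B" for h
    using conn[OF e0(1) that] e0 unfolding P_def by (meson rtrancl_imp_relpow)
  have P_d: "P h (d h)" if "h \<in> edges B" for h
    unfolding d_def using P_ex[OF that] by (rule LeastI_ex)
  have d_le: "d h \<le> m" if "P h m" for h m
    unfolding d_def using that by (rule Least_le)
  have d0: "d h = 0 \<longleftrightarrow> linked h h" if h: "h \<in> edges B" for h
  proof
    assume "d h = 0"
    then show "linked h h" using P_d[OF h] by (auto simp: P_def)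
  next
    assume "linked h h"
    then have "P h 0" using h by (auto simp: P_def)
    then show "d h = 0" using d_le by fastforce
  qed
  have d_step: "d k \<le> Suc (d h)" if "h \<in> edges B" "k \<in> edges B" "h \<noteq> k" "linked h k" for h k
  proof -
    have "(h, k) \<in> link_rel" using that by (simp add: link_rel_def)
    then have "P k (Suc (d h))" using P_d[OF that(1)] unfolding P_def by (meson relpow_Suc_I)
    then show ?thesis by (rule d_le)
  qed
  define n where "n = d g"
  obtain e where e: "e \<in> edges B" "linked e e" "(e, g) \<in> link_rel ^^ n"
    using P_d[OF g] unfolding P_def n_def by blast
  then obtain v where v: "v 0 = e" "v n = g" "\<And>i. i < n \<Longrightarrow> (v i, v (Suc i)) \<in> link_rel"
    unfolding relpow_fun_conv by blast
  have vE: "v i \<in> edges B" if "i \<le> n" for i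
    using that v(3)[of "i - 1"] v(1) e(1) by (cases i) (auto simp: link_rel_def)
  have up: "d (v i) \<le> i" if "i \<le> n" for i
    using that
  proof (induction i)
    case 0
    then show ?case using d0[OF e(1)] e(2) v(1) by simp
  next
    case (Suc i)
    then show ?case using d_step[of "v i" "v (Suc i)"] v(3)[of i] by (auto simp: link_rel_def)
  qed
  \<comment> \<open>Backwards from \<open>g\<close>, whose distance is \<open>n\<close>: one step
    lowers the distance by at most 1.\<close>
  have down: "d (v (n - k)) \<ge> n - k" if "k \<le> n" for k
    using that
  proof (induction k)
    case 0
    then show ?case using v(2) n_def by simp
  next
    case (Suc k)
    then have "(v (n - Suc k), v (n - k)) \<in> link_rel"
      using v(3)[of "n - Suc k"] by (simp add: Suc_diff_Suc)
    then show ?case using d_step[of "v (n - Suc k)" "v (n - k)"] Suc by (auto simp: link_rel_def)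
  qed
  have d_v: "d (v i) = i" if "i \<le> n" for i
    using up[OF that] down[of "n - i"] that by simp
  have inj: "inj_on v {..n}"
  proof (rule inj_onI)
    fix i j assume "i \<in> {..n}" "j \<in> {..n}" and eq: "v i = v j"
    then have "d (v i) = i" "d (v j) = j" using d_v[of i] d_v[of j] by blast+
    then show "i = j" using eq by metis
  qed
  have "linked (v i) (v j) \<longleftrightarrow> j = Suc i \<or> i = Suc j \<or> i = 0 \<and> j = 0"
    if i: "i \<le> n" and j: "j \<le> n" for i j
  proof
    assume l: "linked (v i) (v j)"
    show "j = Suc i \<or> i = Suc j \<or> i = 0 \<and> j = 0"
    proof (cases "i = j")
      case True
      then show ?thesis using l d0[OF vE[OF i]] d_v[OF i] by simp
    next
      case False
      then have "v i \<noteq> v j" using inj i j by (auto dest: inj_onD)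
      moreover have "linked (v j) (v i)" using linked_sym[OF vE[OF i] vE[OF j] l] .
      \<comment> \<open>Distances of linked edges differ by at most 1, and \<open>v i\<close> has
        distance \<open>i\<close>; this excludes chords.\<close>
      ultimately have "j \<le> Suc i" "i \<le> Suc j"
        using d_step[OF vE[OF i] vE[OF j]] d_step[OF vE[OF j] vE[OF i]] l d_v i j by auto
      then show ?thesis using False by linarith
    qed
  next
    have succ: "linked (v i) (v (Suc i))" if "i < n" for i
      using v(3)[OF that] by (simp add: link_rel_def)
    assume "j = Suc i \<or> i = Suc j \<or> i = 0 \<and> j = 0"
    then consider "j = Suc i" | "i = Suc j" | "i = 0" "j = 0" by blast
    then show "linked (v i) (v j)"
    proof cases
      case 1
      then show ?thesis using succ[of i] j by simp
    next
      case 2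
      then show ?thesis using succ[of j] i linked_sym[OF vE[OF j] vE[OF i]] by simp
    next
      case 3
      then show ?thesis using v(1) e(2) by simp
    qed
  qed
  then have "loop_path n v" using vE inj unfolding loop_path_def by blast
  then show ?thesis using v(2) by blast
qed

text \<open>Every edge ends a path from a twisted loop, so \<open>across\<close> never leaves a
  face, and the single vertex lies in a single face. Two positive numbers with sum 2 are both
  1.\<close>

lemma one_face_if_constant:
  assumes conn: "\<And>e h. e \<in> edges B \<Longrightarrow> h \<in> edges B \<Longrightarrow> (e, h) \<in> link_rel\<^sup>*"
    and e0: "e0 \<in> edges B" "linked e0 e0"
    and const: "\<And>A. A \<subseteq> edges B \<Longrightarrow> nf A + nf (edges B - A) = nf (edges B) + 1"
    and A: "A \<subseteq> edges B"
  shows "nf A = 1"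
proof -
  have flat: "(y, ac y) \<in> face (edges B)" if y: "y \<in> FL" for y
  proof -
    have e: "edge_of y \<in> edges B" using y by (simp add: edges_eq)
    obtain n v where v: "loop_path n v" "v n = edge_of y"
      using shortest_path[OF conn e0 e] by blast
    show ?thesis by (rule path_end_flat[OF v(1) const]) (simp_all add: v(2))
  qed
  have "reach FL ar ac \<subseteq> face (edges B)"
    unfolding face_def
    by (rule reach_subset, fold face_def) (use face_around flat in auto)
  then have "nf (edges B) = 1"
    using connected one_face_iff[of "edges B"] by blast
  then show ?thesis
    using const[OF A] nf_pos[of A] nf_pos[of "edges B - A"] by linarith
qed

section \<open>Subgraphs with more than one face\<close>

lemma two_faces:
  assumes A: "A \<subseteq> edges B" and S: "\<And>z. z \<in> FL \<Longrightarrow> ar z \<in> S \<longleftrightarrow> z \<in> S"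
    "\<And>z. z \<in> FL \<Longrightarrow> step A z \<in> S \<longleftrightarrow> z \<in> S"
    and x: "x \<in> FL" "y \<in> FL" "x \<in> S" "y \<notin> S"
  shows "nf A \<noteq> 1"
proof
  assume "nf A = 1"
  then have "(x, y) \<in> face A" using one_face_iff[OF A] x by blast
  then have "y \<in> S" unfolding face_def by (rule reach_closed) (use x S in auto)
  with x show False by blast
qed

text \<open>The separating set is an arc of \<open>e\<close>, which distinguishes the two boundary
  circles of the annulus.\<close>

lemma untwisted_two_faces:
  assumes e: "e \<in> edges B" and no: "\<not> linked e e"
  shows "nf {e} \<noteq> 1"
proof -
  obtain C where C: "is_arc e C" using arc_exists[OF e] by blast
  obtain y where y: "y \<in> e" "y \<in> FL" using edge_nonempty[OF e] by blast
  have st: "step {e} z \<in> C \<longleftrightarrow> z \<in> C" if z: "z \<in> FL" for z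
  proof (cases "z \<in> e")
    case True
    then show ?thesis
      using linked_iff[OF e e C True] no by (simp add: boundary_step_def)
  next
    case False
    then show ?thesis using is_arcD(3)[OF C z] by (simp add: boundary_step_def)
  qed
  have "{e} \<subseteq> edges B" using e by simp
  then show ?thesis
    using two_faces[OF _ is_arcD(2)[OF C] st, of y "ac y"] two_faces[OF _ is_arcD(2)[OF C] st, of "ac y" y]
      is_arcD(3)[OF C y(2)] y by auto
qed

text \<open>The matrix with four entries 1 is singular with kernel vector (1,1). Accordingly the sum
  over GF(2) of an arc of \<open>e\<close> and an arc of \<open>h\<close> separates: along either
  ribbon both memberships change.\<close>

lemma interlaced_twisted_two_faces:
  assumes e: "e \<in> edges B" "linked e e" and h: "h \<in> edges B" "linked h h"
    and neq: "e \<noteq> h" and link: "linked e h"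
  shows "nf {e, h} \<noteq> 1"
proof -
  obtain C where C: "is_arc e C" using arc_exists[OF e(1)] by blast
  obtain D where D: "is_arc h D" using arc_exists[OF h(1)] by blast
  define S where "S = {z. (z \<in> C) \<noteq> (z \<in> D)}"
  have link': "linked h e" by (rule linked_sym[OF e(1) h(1) link])
  have sub: "{e, h} \<subseteq> edges B" using e h by simp
  have ar: "ar z \<in> S \<longleftrightarrow> z \<in> S" if z: "z \<in> FL" for z
    using is_arcD(2)[OF C z] is_arcD(2)[OF D z] by (simp add: S_def)
  have st: "step {e, h} z \<in> S \<longleftrightarrow> z \<in> S" if z: "z \<in> FL" for z
  proof -
    consider "z \<in> e" | "z \<in> h" | "z \<notin> e" "z \<notin> h" by blast
    then show ?thesis
    proof cases
      case 1
      have "(al z \<in> C) \<noteq> (z \<in> C)" "(al z \<in> D) \<noteq> (z \<in> D)"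
        using linked_iff[OF e(1) e(1) C 1] linked_iff[OF h(1) e(1) D 1] e(2) link' by simp_all
      then show ?thesis using 1 by (auto simp: S_def boundary_step_def)
    next
      case 2
      have "(al z \<in> C) \<noteq> (z \<in> C)" "(al z \<in> D) \<noteq> (z \<in> D)"
        using linked_iff[OF e(1) h(1) C 2] linked_iff[OF h(1) h(1) D 2] h(2) link by simp_all
      then show ?thesis using 2 by (auto simp: S_def boundary_step_def)
    next
      case 3
      then show ?thesis
        using is_arcD(3)[OF C z] is_arcD(3)[OF D z] by (simp add: S_def boundary_step_def)
    qed
  qed
  obtain y where y: "y \<in> e" "y \<in> FL" using edge_nonempty[OF e(1)] by blast
  have "y \<notin> h" using edges_disjoint[OF e(1) h(1) y(1)] neq by blast
  then have "ac y \<in> S \<longleftrightarrow> y \<notin> S"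
    using is_arcD(3)[OF C y(2)] is_arcD(3)[OF D y(2)] y(1) by (auto simp: S_def)
  then show ?thesis
    using two_faces[OF sub ar st, of y "ac y"] two_faces[OF sub ar st, of "ac y" y] y by auto
qed

subsection \<open>Euler genera of partial duals\<close>

text \<open>Partial duality swaps \<open>across\<close> and \<open>along\<close> on
  \<open>A\<close>, which does not affect the union of the two relations.\<close>

lemma edges_partial_dual: "edges (partial_dual B A) = edges B"
proof -
  have "{(x, step A x) |x. x \<in> FL} \<union> {(x, if x \<in> \<Union>A then ac x else al x) |x. x \<in> FL}
      = {(x, ac x) |x. x \<in> FL} \<union> {(x, al x) |x. x \<in> FL}" (is "?L = ?R")
  proof (intro equalityI subrelI)
    fix u v assume "(u, v) \<in> ?L"
    then show "(u, v) \<in> ?R" by (cases "u \<in> \<Union>A") (auto simp: boundary_step_def)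
  next
    fix u v assume "(u, v) \<in> ?R"
    then show "(u, v) \<in> ?L" by (cases "u \<in> \<Union>A") (auto simp: boundary_step_def)
  qed
  then show ?thesis by (simp add: edges_def orbits_of_def partial_dual_def)
qed

text \<open>In the dual the free sides of ribbons in \<open>A\<close> are their former ends, so its
  faces are traced by the boundary of the complementary subgraph.\<close>

lemma euler_genus_partial_dual:
  assumes A: "A \<subseteq> edges B"
  shows "euler_genus (partial_dual B A) = 2 + int (num_edges B) - int (nf A) - int (nf (edges B - A))"
proof -
  have v: "num_vertices (partial_dual B A) = nf A"
    by (simp add: num_vertices_def num_boundary_components_def partial_dual_def)
  have "boundary_step (partial_dual B A) (edges B) x = step (edges B - A) x" if x: "x \<in> FL" for x
  proof -
    have e: "edge_of x \<in> edges B" using x by (simp add: edges_eq)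
    have "x \<in> \<Union>(edges B)" using x Union_edges by simp
    moreover have "x \<in> \<Union>A \<longleftrightarrow> edge_of x \<in> A" by (rule in_Union_iff[OF A e edge_of_self])
    moreover have "x \<in> \<Union>(edges B - A) \<longleftrightarrow> edge_of x \<in> edges B - A"
      by (rule in_Union_iff[OF _ e edge_of_self]) blast
    ultimately show ?thesis using e by (auto simp: boundary_step_def partial_dual_def)
  qed
  then have "orbits_of FL ar (boundary_step (partial_dual B A) (edges B)) =
      orbits_of FL ar (step (edges B - A))"
    by (rule orbits_of_cong)
  then have "num_faces (partial_dual B A) = nf (edges B - A)"
    unfolding num_faces_def edges_partial_dual
    by (simp add: num_boundary_components_def partial_dual_def)
  with v edges_partial_dual show ?thesis by (simp add: euler_genus_def num_edges_def)
qed

lemma euler_genus_partial_dual_nonneg: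
  assumes A: "A \<subseteq> edges B"
  shows "euler_genus (partial_dual B A) \<ge> 0"
proof -
  have "card A + card (edges B - A) = num_edges B"
    using A finite_edges unfolding num_edges_def
    by (metis card_Diff_subset card_mono finite_subset le_add_diff_inverse)
  moreover have "nf A \<le> card A + 1" "nf (edges B - A) \<le> card (edges B - A) + 1"
    using nf_le_card A by auto
  ultimately show ?thesis unfolding euler_genus_partial_dual[OF A] by linarith
qed

text \<open>The coefficient at \<open>b\<close> counts the subsets of genus \<open>b\<close>, so it
  reaches \<open>2 ^ num_edges B\<close> only if all subsets have this genus. Comparing
  \<open>A\<close> with \<open>{}\<close>, which has one face, gives the equation.\<close>

lemma constant_if_monom:
  assumes poly: "partial_dual_genus_poly B = monom (2 ^ num_edges B) b" and A: "A \<subseteq> edges B"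
  shows "nf A + nf (edges B - A) = nf (edges B) + 1"
proof -
  let ?g = "\<lambda>A. nat (euler_genus (partial_dual B A))"
  have "coeff (partial_dual_genus_poly B) b = (\<Sum>A\<in>Pow (edges B). if ?g A = b then 1 else 0)"
    by (simp add: partial_dual_genus_poly_def coeff_sum)
  also have "\<dots> = int (card {A \<in> Pow (edges B). ?g A = b})"
    using finite_edges by (simp add: sum.If_cases Int_def)
  finally have "int (card {A \<in> Pow (edges B). ?g A = b}) = 2 ^ num_edges B" by (simp add: poly)
  also have "\<dots> = int (card (Pow (edges B)))"
    using finite_edges by (simp add: card_Pow num_edges_def)
  finally have "card {A \<in> Pow (edges B). ?g A = b} = card (Pow (edges B))" by (simp only: of_nat_eq_iff)
  then have "{A \<in> Pow (edges B). ?g A = b} = Pow (edges B)"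
    using finite_edges by (intro card_subset_eq) auto
  then have g: "?g A = b" if "A \<subseteq> edges B" for A using that by blast
  have "euler_genus (partial_dual B A) = euler_genus (partial_dual B {})"
    using g[OF A] g[of "{}"] euler_genus_partial_dual_nonneg[OF A]
      euler_genus_partial_dual_nonneg[of "{}"] by simp
  then show ?thesis
    using one_face_empty unfolding euler_genus_partial_dual[OF A]
      euler_genus_partial_dual[OF empty_subsetI] by simp
qed

subsection \<open>One twisted loop\<close>

lemma equiv_twisted_loop_bouquet:
  assumes one_edge: "edges B = {FL}" and twisted: "linked FL FL"
  shows "ribbon_equiv B twisted_loop_bouquet"
proof -
  have E: "FL \<in> edges B" using one_edge by simp
  obtain C where C: "is_arc FL C" using arc_exists[OF E] by blast
  obtain y where y: "y \<in> FL" using nonempty by blast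
  have FL_eq: "FL = {y, ac y, al y, ac (al y)}"
    using edge_eq[OF E y] by (simp add: edge_of_def)
  \<comment> \<open>\<open>around\<close> stays on the arc while \<open>across\<close> and
    \<open>along\<close> both leave it, so \<open>around\<close> can only be their product.\<close>
  have ar: "ar z = ac (al z)" if z: "z \<in> FL" for z
  proof -
    have "ac z \<in> C \<longleftrightarrow> z \<notin> C" "al z \<in> C \<longleftrightarrow> z \<notin> C" "ar z \<in> C \<longleftrightarrow> z \<in> C"
      using is_arcD[OF C] linked_iff[OF E E C z] twisted z by auto
    then have "ar z \<noteq> ac z" "ar z \<noteq> al z" by metis+
    moreover have "ar z \<in> edge_of z" using z by (simp add: edge_eq[OF E z, symmetric])
    ultimately show ?thesis using z by (auto simp: edge_of_def)
  qed
  have "ac (al y) \<noteq> y" "ac (al y) \<noteq> ac y" using y flag_maps by metis+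
  then have neq: "y \<noteq> ac (al y)" "ac y \<noteq> ac (al y)" "ac (al y) \<noteq> y" "ac (al y) \<noteq> ac y"
    by metis+
  define \<phi> :: "'a \<Rightarrow> nat \<times> bool" where "\<phi> z = (if z = y then (0, False) else if z = ac y then (0, True)
    else if z = al y then (Suc 0, False) else (Suc 0, True))" for z
  have \<phi>: "\<phi> y = (0, False)" "\<phi> (ac y) = (0, True)" "\<phi> (al y) = (Suc 0, False)"
    "\<phi> (ac (al y)) = (Suc 0, True)"
    using y neq by (simp_all add: \<phi>_def)
  have img: "\<phi> ` FL = flags twisted_loop_bouquet"
    unfolding FL_eq flags_twisted_loop_bouquet by (simp add: \<phi>)
  moreover have "card FL = card (flags twisted_loop_bouquet)"
    using card_flags one_edge by (simp add: num_edges_def flags_twisted_loop_bouquet)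
  ultimately have "bij_betw \<phi> FL (flags twisted_loop_bouquet)"
    using finite_flags by (simp add: bij_betw_def eq_card_imp_inj_on)
  moreover have "\<phi> (ac x) = across twisted_loop_bouquet (\<phi> x) \<and>
      \<phi> (al x) = along twisted_loop_bouquet (\<phi> x) \<and>
      \<phi> (ar x) = around twisted_loop_bouquet (\<phi> x)" if x: "x \<in> FL" for x
  proof -
    from x FL_eq consider "x = y" | "x = ac y" | "x = al y" | "x = ac (al y)" by blast
    then show ?thesis
      unfolding ar[OF x] by cases (simp_all add: \<phi> y)
  qed
  ultimately show ?thesis
    unfolding ribbon_equiv_def using isolated_eq_0 by auto
qed

lemma edges_if_num_edges_1:
  assumes "num_edges B = 1"
  shows "edges B = {FL}"
proof -
  obtain e where "edges B = {e}" using assms unfolding num_edges_def by (rule card_1_singletonE)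
  then show ?thesis using Union_edges by simp
qed

text \<open>Each of the two subsets has one face, as does its complement: the genus is 2 + 1 - 1 - 1
  = 1.\<close>

lemma monom_if_twisted_loop:
  assumes one_edge: "edges B = {FL}" and twisted: "linked FL FL"
  shows "partial_dual_genus_poly B = monom (2 ^ num_edges B) 1"
proof -
  have "nf {FL} = 1" using one_face_twisted_loop[OF _ twisted] one_edge by simp
  moreover have "num_edges B = 1" using one_edge by (simp add: num_edges_def)
  ultimately have "euler_genus (partial_dual B A) = 1" if "A = {} \<or> A = {FL}" for A
    using that euler_genus_partial_dual[of A] one_face_empty one_edge by auto
  moreover have "Pow (edges B) = {{}, {FL}}" using one_edge by auto
  ultimately show ?thesis
    using \<open>num_edges B = 1\<close>
    by (simp add: partial_dual_genus_poly_def) (simp only: mult_2 add_monom one_add_one)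
qed

end

theorem theorem26:
  fixes B :: "'a ribbon_graph"
  assumes "prime_bouquet B" and "\<not> orientable B"
  shows "(\<exists>b::nat. partial_dual_genus_poly B = monom (2 ^ num_edges B) b)
     \<longleftrightarrow> ribbon_equiv B twisted_loop_bouquet"
proof -
  interpret one_vertex B
  proof
    show "ribbon_graph B" "num_vertices B = 1"
      using assms(1) by (simp_all add: prime_bouquet_def bouquet_def)
    show "flags B \<noteq> {}" using assms(2) by (auto simp: orientable_def)
  qed
  obtain e where e: "e \<in> edges B" "linked e e"
    using orientable_if_untwisted assms(2) by blast
  show ?thesis
  proof
    assume "\<exists>b. partial_dual_genus_poly B = monom (2 ^ num_edges B) b"
    then obtain b where b: "partial_dual_genus_poly B = monom (2 ^ num_edges B) b" ..
    have conn: "(e, h) \<in> link_rel\<^sup>*" if "e \<in> edges B" "h \<in> edges B" for e h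
      using link_rel_connected[OF _ that] assms(1) by (simp add: prime_bouquet_def)
    have one: "nf A = 1" if "A \<subseteq> edges B" for A
      by (rule one_face_if_constant[OF conn e constant_if_monom[OF b] that])
    have twisted: "linked h h" if "h \<in> edges B" for h
      using untwisted_two_faces[OF that] one[of "{h}"] that by auto
    have "link_rel = {}"
      using interlaced_twisted_two_faces twisted one by (auto simp: link_rel_def)
    then have "h = e" if "h \<in> edges B" for h
      using conn[OF e(1) that] by simp
    then have "edges B = {e}" using e(1) by blast
    then have "edges B = {FL}" using Union_edges by simp
    then show "ribbon_equiv B twisted_loop_bouquet"
      using equiv_twisted_loop_bouquet twisted by simp
  next
    assume "ribbon_equiv B twisted_loop_bouquet"
    then obtain \<phi> where "bij_betw \<phi> FL (flags twisted_loop_bouquet)"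
      unfolding ribbon_equiv_def by blast
    \<comment> \<open>Four flags mean a single edge, and this edge is twisted by non-orientability
      of \<open>B\<close>.\<close>
    then have "card FL = 4"
      using bij_betw_same_card by (fastforce simp: flags_twisted_loop_bouquet)
    then have one_edge: "edges B = {FL}"
      using card_flags by (intro edges_if_num_edges_1) simp
    then have "e = FL" using e(1) by simp
    then have "linked FL FL" using e(2) by simp
    then show "\<exists>b. partial_dual_genus_poly B = monom (2 ^ num_edges B) b"
      by (intro exI[of _ 1] monom_if_twisted_loop[OF one_edge])
  qed
qed

end
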